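(* Let $n\ge 1$ be an integer, let $\mathbb{P}$ be a finite $2$-group that is neither cyclic nor of maximal class, and let $\mathcal{G}$ be a finite nilpotent group of odd order having no cyclic Sylow subgroups, where $\gcd(n,|\mathcal{G}|)=\gcd(n,2)=1$. Let $G=\mathbb{Z}_n\times\mathbb{P}\times\mathcal{G}$. Then the non-cyclic graph $\Gamma(G)$ is Hamiltonian.
   Context: For a finite non-cyclic group $G$, $\mathrm{Cyc}(G)=\{x\in G:\langle x,y\rangle\text{ is cyclic for all }y\in G\}$. The non-cyclic graph $\Gamma(G)$ is the simple undirected graph with vertex set $G\setminus\mathrm{Cyc}(G)$ in which two distinct vertices $x,y$ are adjacent if and only if the subgroup $\langle x,y\rangle$ is not cyclic. A graph is Hamiltonian if it contains a cycle passing through all its vertices. "$\mathcal{G}$ has no cyclic Sylow subgroups" means that for every prime $p$ dividing $|\mathcal{G}|$ the Sylow $p$-subgroup of $\mathcal{G}$ is non-cyclic; the trivial group is allowed as $\mathcal{G}$. A non-cyclic $2$-group $H$ of order $2^m$ ($m\ge 2$) is of maximal class if $H^{(m-1)}\ne\{e\}$ and $H^{(m)}=\{e\}$, where $H^{(1)}=H$, $H^{(i+1)}=[H^{(i)},H]$ is the lower central series. These are exactly the groups $\mathcal{D}_{2^{t+1}}=\langle a,b: a^{2^t}=b^2=1,\ b^{-1}ab=a^{-1}\rangle$ ($t\ge1$), $\mathcal{Q}_{2^{t+1}}=\langle a,b: a^{2^t}=1,\ a^{2^{t-1}}=b^2,\ b^{-1}ab=a^{-1}\rangle$ ($t\ge2$),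 and $\mathcal{SD}_{2^{t+1}}=\langle a,b: a^{2^t}=b^2=1,\ b^{-1}ab=a^{-1+2^{t-1}}\rangle$ ($t\ge3$). *)

theory Defs
  imports "HOL-Algebra.Algebra" "Graph_Theory.Pair_Digraph"
begin

text \<open>The subgroup \<open>[H, K]\<close>, with the commutator convention of \<^const>\<open>derived\<close>; for subgroups
  \<open>H\<close> and \<open>K\<close> the convention does not affect the generated subgroup.\<close>

definition commutator_subgroup :: "('a, 'b) monoid_scheme \<Rightarrow> 'a set \<Rightarrow> 'a set \<Rightarrow> 'a set" where
  "commutator_subgroup G H K =
     generate G (\<Union>h\<in>H. \<Union>k\<in>K. {h \<otimes>\<^bsub>G\<^esub> k \<otimes>\<^bsub>G\<^esub> (inv\<^bsub>G\<^esub> h) \<otimes>\<^bsub>G\<^esub> (inv\<^bsub>G\<^esub> k)})"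

text \<open>The numbering starts at \<open>1\<close>: \<open>lower_central G 1\<close> is the whole group. The value at \<open>0\<close> is
  also the whole group, by truncated subtraction, and plays no role.\<close>

definition lower_central :: "('a, 'b) monoid_scheme \<Rightarrow> nat \<Rightarrow> 'a set" where
  "lower_central G i = ((\<lambda>H. commutator_subgroup G H (carrier G)) ^^ (i - 1)) (carrier G)"

definition nilpotent_group :: "('a, 'b) monoid_scheme \<Rightarrow> bool" where
  "nilpotent_group G \<longleftrightarrow> group G \<and> (\<exists>i\<ge>1. lower_central G i = {\<one>\<^bsub>G\<^esub>})"

definition maximal_class_2_group :: "('a, 'b) monoid_scheme \<Rightarrow> bool" where
  "maximal_class_2_group H \<longleftrightarrow>
     group H \<and> \<not> cyclic_group H \<and>
     (\<exists>m\<ge>2. order H = 2 ^ m \<and> lower_central H (m - 1) \<noteq> {\<one>\<^bsub>H\<^esub>} \<and> lower_central H m = {\<one>\<^bsub>H\<^esub>})"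

definition sylow_subgroup :: "('a, 'b) monoid_scheme \<Rightarrow> nat \<Rightarrow> 'a set \<Rightarrow> bool" where
  "sylow_subgroup G p S \<longleftrightarrow> subgroup S G \<and> card S = p ^ multiplicity p (order G)"

definition no_cyclic_sylow :: "('a, 'b) monoid_scheme \<Rightarrow> bool" where
  "no_cyclic_sylow G \<longleftrightarrow>
     (\<forall>p S. Factorial_Ring.prime p \<and> p dvd order G \<and> sylow_subgroup G p S \<longrightarrow> \<not> cyclic_group (G\<lparr>carrier := S\<rparr>))"

definition Cyc :: "('a, 'b) monoid_scheme \<Rightarrow> 'a set" where
  "Cyc G = {x \<in> carrier G. \<forall>y\<in>carrier G. cyclic_group (subgroup_generated G {x, y})}"

text \<open>Undirected graphs are symmetric digraphs: each edge is represented by its two arcs.\<close>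

definition noncyclic_graph :: "('a, 'b) monoid_scheme \<Rightarrow> 'a pair_pre_digraph" where
  "noncyclic_graph G =
     \<lparr>pverts = carrier G - Cyc G,
      parcs = {(x, y). x \<in> carrier G - Cyc G \<and> y \<in> carrier G - Cyc G \<and> x \<noteq> y \<and>
                 \<not> cyclic_group (subgroup_generated G {x, y})}\<rparr>"

lemma pair_graph_noncyclic_graph:
  assumes "finite (carrier G)"
  shows "pair_graph (noncyclic_graph G)"
proof
  have "parcs (noncyclic_graph G) \<subseteq> carrier G \<times> carrier G"
    by (auto simp: noncyclic_graph_def)
  then show "finite (parcs (noncyclic_graph G))"
    by (rule finite_subset) (simp add: assms)
  show "symmetric (with_proj (noncyclic_graph G))"
    by (auto simp: symmetric_def sym_def noncyclic_graph_def insert_commute)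
qed (use assms in \<open>auto simp: noncyclic_graph_def\<close>)

text \<open>The bound \<open>length p \<ge> 3\<close> is needed because \<^const>\<open>pre_digraph.cycle\<close> counts traversing
  a single edge back and forth as a cycle of length \<open>2\<close>.\<close>

definition hamiltonian :: "('a, 'b) pre_digraph \<Rightarrow> bool" where
  "hamiltonian \<Gamma> \<longleftrightarrow>
     (\<exists>p. pre_digraph.cycle \<Gamma> p \<and> length p \<ge> 3 \<and> tail \<Gamma> ` set p = verts \<Gamma>)"

end

theory Submission
  imports Defs "HOL-Number_Theory.Residues"
begin

text \<open>Two elements of \<open>\<int>\<^sub>n \<times> P \<times> \<G>\<close> are adjacent as soon as their components in \<open>P\<close>, or those in
  \<open>\<G>\<close>, lie in no common cyclic subgroup. In \<open>P\<close>, which is neither cyclic nor of maximal class, no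
  cyclic subgroup of order \<open>2^k\<close> with \<open>k \<ge> 1\<close> is the only one of its order. Since two elements of equal
  order lie in a common cyclic subgroup iff they generate the same one, the elements of a given order
  can be ordered cyclically so that neighbours are adjacent. Joining these levels by decreasing
  order, and closing up with the involutions (of which there are at least three), gives a Hamiltonian
  cycle \<open>p\<^sub>1, \<dots>, p\<^sub>M\<close> on \<open>P - {1}\<close>. The same uniqueness argument for odd primes gives a permutation
  \<open>f\<close> of \<open>\<G> - {1}\<close> such that \<open>h\<close> and \<open>f h\<close> lie in no common cyclic subgroup. Concatenating the paths
  \<open>(z, p\<^sub>1, h), (z, 1, f h), (z, p\<^sub>2, h), \<dots>, (z, p\<^sub>M, h)\<close> (without the second vertex if \<open>h = 1\<close>) over all
  \<open>(z, h)\<close> traverses everything except the elements \<open>(z, 1, 1)\<close>, which belong to \<open>Cyc\<close>.\<close>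

section \<open>Powers and orders in finite groups\<close>

text \<open>The obstacle is the prime 2. If <c> is the only cyclic subgroup of its order p^k, k
  \<ge> 2, it is normal, so an element y with y^p = 1 acts on it by c -> c^r, and (c y)^p = c^(1 + r
  + ... + r^(p-1)). This exponent is p times a unit once r = 1 modulo p and, for p = 2, also modulo
  4. Then c y has the order of c, which forces y into <c>; for odd p cyclicity follows. The
  congruence modulo p is automatic, but the one modulo 4 can fail, and quaternion groups have a
  single involution without being cyclic. So for p = 2 the argument runs only in the centraliser of
  an element of order 4. That centraliser becomes cyclic of index at most 2, and if the index is 2,
  the other coset inverts the element of order 4, which yields maximal class. Order 2 is treated
  apart because there an element of order 4 spanning a normal subgroup has first to be found.

  The permutation \<open>f\<close> is there for the elements with trivial component in P: only their
  components in \<open>\<G>\<close> can make them adjacent to anything, and each copy of the path in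
  P takes in exactly one of them.\<close>

lemma sum_powers_eq_prime_times_unit:
  fixes p r :: nat
  assumes p: "Factorial_Ring.prime p" and r: "[r = 1] (mod p)" and two: "p = 2 \<Longrightarrow> [r = 1] (mod 4)"
  obtains w where "(\<Sum>t<p. r ^ t) = p * w" "coprime w p"
proof -
  obtain u where u: "(\<Sum>t<p. int r ^ t) = int p * u" "\<not> int p dvd u"
  proof (cases "p = 2")
    case True
    then have "[int r = 1] (mod 4)" using two by (metis cong_int_iff of_nat_1 of_nat_numeral)
    then obtain k where k: "int r = 1 + 4 * k" using cong_iff_lin[of 1 "int r" 4] by (auto simp: cong_sym_eq)
    have "{..<p} = {0, 1}" using True by auto
    then have "(\<Sum>t<p. int r ^ t) = 1 + int r" by simp
    also have "\<dots> = int p * (1 + 2 * k)" unfolding k True by simp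
    finally have "(\<Sum>t<p. int r ^ t) = int p * (1 + 2 * k)" .
    moreover have "\<not> int p dvd 1 + 2 * k" using True by simp
    ultimately show thesis by (rule that)
  next
    case False
    then have "odd p" using False p prime_odd_nat prime_ge_2_nat by (metis le_neq_implies_less)
    then obtain h where h: "p = 2 * h + 1" by (elim oddE)
    have "[int r = 1] (mod int p)" using r by (metis cong_int_iff of_nat_1)
    then obtain k where k: "int r = 1 + int p * k" using cong_iff_lin[of 1 "int r" "int p"] by (auto simp: cong_sym_eq)
    \<comment> \<open>Modulo p^2 only the linear term of (1 + p k)^t survives, so the sum becomes p
      + p k (0 + ... + (p - 1)).\<close>
    have pw: "[int r ^ t = 1 + int t * (int p * k)] (mod (int p * int p))" for t
    proof (induction t)
      case (Suc t)
      have "[int r ^ Suc t = (1 + int p * k) * (1 + int t * (int p * k))] (mod (int p * int p))"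
        using cong_scalar_left[OF Suc] k by simp
      moreover have "(1 + int p * k) * (1 + int t * (int p * k))
          = 1 + int (Suc t) * (int p * k) + (int p * int p) * (int t * k * k)"
        by (simp add: algebra_simps)
      ultimately show ?case by (metis (no_types, lifting) cong_add_lcancel_0 cong_mult_self_left cong_trans)
    qed simp
    \<comment> \<open>Oddness of p enters here: p (p - 1) / 2 is a multiple of p, so the linear
      terms add up to 0 modulo p^2. For p = 2 this breaks down, hence the separate condition modulo
      4.\<close>
    have sq: "(\<Sum>t<p. int t) = int h * int p"
    proof -
      have "2 * (\<Sum>t<m. int t) = int m * (int m - 1)" for m by (induction m) (auto simp: algebra_simps)
      from this[of p] have "2 * (\<Sum>t<p. int t) = 2 * (int h * int p)" using h by (simp add: algebra_simps)
      then show ?thesis by simp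
    qed
    have "[(\<Sum>t<p. int r ^ t) = (\<Sum>t<p. 1 + int t * (int p * k))] (mod (int p * int p))"
      by (rule cong_sum) (rule pw)
    also have "(\<Sum>t<p. 1 + int t * (int p * k)) = int p + (int p * int p) * (int h * k)"
    proof -
      have "(\<Sum>t<p. int t * (int p * k)) = int h * int p * (int p * k)"
        unfolding sum_distrib_right[symmetric] sq ..
      then show ?thesis by (simp add: sum.distrib algebra_simps)
    qed
    also have "[\<dots> = int p] (mod (int p * int p))" by (simp add: cong_def)
    finally obtain q where q: "int p = (\<Sum>t<p. int r ^ t) + (int p * int p) * q" unfolding cong_iff_lin by blast
    have "(\<Sum>t<p. int r ^ t) = int p * (1 - int p * q)" using q by (simp add: algebra_simps)
    moreover have "\<not> int p dvd (1 - int p * q)"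
    proof
      assume "int p dvd (1 - int p * q)"
      then have "int p dvd (1 - int p * q) + int p * q" by (rule dvd_add) simp
      then have "int p dvd 1" by simp
      then show False using p by (metis int_dvd_int_iff not_prime_unit of_nat_1)
    qed
    ultimately show thesis using that by blast
  qed
  have "int p dvd int (\<Sum>t<p. r ^ t)" using u(1) by simp
  then obtain w where w: "(\<Sum>t<p. r ^ t) = p * w" by (meson dvdE int_dvd_int_iff)
  have "int p * int w = int (\<Sum>t<p. r ^ t)" unfolding w by simp
  also have "\<dots> = int p * u" using u(1) by simp
  finally have "int p * int w = int p * u" .
  moreover have "int p \<noteq> 0" using p by auto
  ultimately have "int w = u" using mult_left_cancel by blast
  then have "\<not> p dvd w" using u(2) by auto
  then have "coprime w p" using p by (simp add: coprime_commute prime_imp_coprime)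
  with w that show thesis by blast
qed

locale finite_group = group G for G (structure) +
  assumes finite_carrier: "finite (carrier G)"
begin

lemma ord_pos: "x \<in> carrier G \<Longrightarrow> 0 < ord x"
  using ord_ge_1[OF finite_carrier] by fastforce

lemma in_generate_iff: "x \<in> carrier G \<Longrightarrow> y \<in> generate G {x} \<longleftrightarrow> (\<exists>k::nat. y = x [^] k)"
  using generate_pow_on_finite_carrier[OF finite_carrier] by auto

lemma card_generate: "x \<in> carrier G \<Longrightarrow> card (generate G {x}) = ord x"
  using generate_pow_card[symmetric] .

lemma pow_cong:
  assumes "x \<in> carrier G"
  shows "x [^] (a::nat) = x [^] (b::nat) \<longleftrightarrow> [a = b] (mod ord x)"
proof -
  have "x [^] a = x [^] b \<longleftrightarrow> x [^] int a = x [^] int b" by (simp add: int_pow_int)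
  also have "\<dots> \<longleftrightarrow> [a = b] (mod ord x)"
    using assms by (simp add: int_pow_eq flip: cong_int_iff) (simp add: cong_iff_dvd_diff dvd_diff_commute)
  finally show ?thesis .
qed

lemma generate_subset_carrier: "x \<in> carrier G \<Longrightarrow> generate G {x} \<subseteq> carrier G"
  using generate_incl by simp

lemma generate_mono_elem:
  "x \<in> carrier G \<Longrightarrow> y \<in> generate G {x} \<Longrightarrow> generate G {y} \<subseteq> generate G {x}"
  using generate_is_subgroup generate_subgroup_incl by (metis empty_subsetI insert_subset)

lemma generate_eq_of_ord_eq:
  assumes "x \<in> carrier G" "y \<in> generate G {x}" "ord y = ord x"
  shows "generate G {y} = generate G {x}"
proof -
  have "y \<in> carrier G" using assms generate_subset_carrier by blast
  then show ?thesis
    using assms generate_mono_elem card_generate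
    by (metis card_subset_eq finite_carrier finite_subset generate_subset_carrier)
qed

lemma generate_self: "x \<in> carrier G \<Longrightarrow> x \<in> generate G {x}"
  by (simp add: generate.incl)

lemma generate_in_subgroup: "subgroup H G \<Longrightarrow> x \<in> H \<Longrightarrow> generate G {x} \<subseteq> H"
  using generate_subgroup_incl by (metis empty_subsetI insert_subset)

lemma pow_in_generate: "x \<in> carrier G \<Longrightarrow> x [^] (k::nat) \<in> generate G {x}"
  using in_generate_iff by blast

lemma coprime_pow_generates:
  assumes "x \<in> carrier G" "coprime k (ord x)"
  shows "x \<in> generate G {x [^] (k::nat)}"
proof -
  have "ord (x [^] k) = ord x" using assms pow_ord_eq_ord_iff[OF finite_carrier] by simp
  then show ?thesis
    using generate_eq_of_ord_eq[OF assms(1) pow_in_generate[OF assms(1)]] generate_self[OF assms(1)] by simp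
qed

text \<open>A cyclic group has one subgroup for each divisor of its order, so inside <c> membership
  is decided by divisibility of orders. The later arguments that two elements lie in no common
  cyclic subgroup rest on this.\<close>

lemma generate_of_ord_dvd:
  assumes "c \<in> carrier G" "x \<in> generate G {c}" "y \<in> generate G {c}" "ord y dvd ord x"
  shows "y \<in> generate G {x}"
proof -
  obtain a b :: nat where a: "x = c [^] a" and b: "y = c [^] b" using assms in_generate_iff by blast
  define N where "N = ord c"
  have N0: "N > 0" using ord_pos assms N_def by blast
  have x: "x \<in> carrier G" using a assms by simp
  \<comment> \<open>By Bezout some power of x is c^(gcd a N); it remains to see that
    \<open>gcd a N\<close> divides b.\<close>
  have "\<exists>k. [a * k = gcd a N] (mod N)" by (metis cong_solve_nat)
  then obtain k where k: "[a * k = gcd a N] (mod N)" by blast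
  then have "x [^] k = c [^] gcd a N" using pow_cong assms(1) a N_def by (simp add: nat_pow_pow)
  moreover have "gcd a N dvd b"
  proof -
    have "y [^] ord x = \<one>" using assms(4) pow_eq_id[of y] b assms(1) by simp
    then have "N dvd b * ord x" using b assms(1) N_def by (simp add: nat_pow_pow pow_eq_id)
    moreover have "N dvd gcd a N * ord x"
    proof -
      have "(x [^] k) [^] ord x = \<one>" using x by (metis nat_pow_one nat_pow_pow mult.commute pow_ord_eq_1)
      then show ?thesis using \<open>x [^] k = c [^] gcd a N\<close> assms(1) N_def by (simp add: nat_pow_pow pow_eq_id)
    qed
    moreover have "gcd a N * ord x dvd N"
    proof -
      have "ord x dvd N div gcd a N"
      proof -
        have "N dvd a * (N div gcd a N)" 
          by (metis dvd_triv_right div_mult_swap dvd_div_mult gcd_dvd1 gcd_dvd2)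
        then have "x [^] (N div gcd a N) = \<one>"
          using a assms(1) N_def by (simp add: nat_pow_pow pow_eq_id)
        then show ?thesis using x pow_eq_id by simp
      qed
      then show ?thesis by (metis dvd_mult_div_cancel gcd_dvd2 mult_dvd_mono dvd_refl)
    qed
    ultimately have "gcd a N * ord x dvd b * ord x" by (meson dvd_trans)
    then show ?thesis using ord_pos[OF x] by simp
  qed
  then obtain j where "b = gcd a N * j" by blast
  ultimately have "y = x [^] (k * j)" using b assms(1) x by (metis nat_pow_pow)
  then show ?thesis using pow_in_generate x by simp
qed

section \<open>Powers of products d^i x when x normalises <d>\<close>

lemma conj_pow:
  assumes x: "x \<in> carrier G" and d: "d \<in> carrier G" and r: "x \<otimes> d = d [^] (r::nat) \<otimes> x"
  shows "x \<otimes> d [^] (i::nat) = d [^] (i * r) \<otimes> x"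
proof (induction i)
  case (Suc i)
  have "x \<otimes> d [^] Suc i = (x \<otimes> d [^] i) \<otimes> d" using x d by (simp add: m_assoc)
  also have "\<dots> = d [^] (i * r) \<otimes> (x \<otimes> d)" using Suc x d by (simp add: m_assoc)
  also have "\<dots> = d [^] (i * r) \<otimes> d [^] r \<otimes> x" using x d by (simp add: r m_assoc)
  also have "d [^] (i * r) \<otimes> d [^] r = d [^] (Suc i * r)" using d by (simp add: nat_pow_mult add.commute)
  finally show ?case .
qed (use x in simp)

lemma pow_conj_pow:
  assumes x: "x \<in> carrier G" and d: "d \<in> carrier G" and r: "x \<otimes> d = d [^] (r::nat) \<otimes> x"
  shows "x [^] (n::nat) \<otimes> d = d [^] (r ^ n) \<otimes> x [^] n"
proof (induction n)
  case (Suc n)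
  have "x [^] Suc n \<otimes> d = x [^] n \<otimes> (x \<otimes> d)" using x d by (simp add: m_assoc)
  also have "\<dots> = x [^] n \<otimes> d [^] r \<otimes> x" using x d r by (simp add: m_assoc)
  also have "\<dots> = d [^] (r * r ^ n) \<otimes> x [^] n \<otimes> x" using conj_pow[OF _ d Suc] x by simp
  finally show ?case using x d by (simp add: m_assoc)
qed (use x d in simp)

text \<open>Collecting the factors d^i on the left moves the one preceded by t copies of x past
  them, which multiplies its exponent by r^t. This is the origin of the geometric sum.\<close>

lemma mult_pow_of_conj:
  assumes x: "x \<in> carrier G" and d: "d \<in> carrier G" and r: "x \<otimes> d = d [^] (r::nat) \<otimes> x"
  shows "(d [^] (i::nat) \<otimes> x) [^] (n::nat) = d [^] (i * (\<Sum>t<n. r ^ t)) \<otimes> x [^] n"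
proof (induction n)
  case (Suc n)
  have "(d [^] i \<otimes> x) [^] Suc n = d [^] (i * (\<Sum>t<n. r ^ t)) \<otimes> (x [^] n \<otimes> d [^] i) \<otimes> x"
    using Suc x d by (simp add: m_assoc)
  also have "x [^] n \<otimes> d [^] i = d [^] (i * r ^ n) \<otimes> x [^] n"
    by (rule conj_pow[OF nat_pow_closed[OF x] d pow_conj_pow[OF x d r]])
  also have "d [^] (i * (\<Sum>t<n. r ^ t)) \<otimes> (d [^] (i * r ^ n) \<otimes> x [^] n) \<otimes> x
    = (d [^] (i * (\<Sum>t<n. r ^ t)) \<otimes> d [^] (i * r ^ n)) \<otimes> (x [^] n \<otimes> x)"
    using x d by (simp add: m_assoc)
  also have "d [^] (i * (\<Sum>t<n. r ^ t)) \<otimes> d [^] (i * r ^ n) = d [^] (i * (\<Sum>t<Suc n. r ^ t))"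
    using d by (simp add: nat_pow_mult algebra_simps)
  finally show ?case by simp
qed simp

end

section \<open>Fixed points of actions of p-groups\<close>

text \<open>Orbits outside the fixed-point set have size a power of p other than 1. The action is
  given by bare equations on E, which suits cosets; \<open>\<phi>\<close> repackages it as a
  homomorphism to \<open>BijGroup E\<close> so that the orbit-stabilizer theorem applies.\<close>

lemma (in group) p_group_fixed_points:
  assumes p: "Factorial_Ring.prime p" and H: "subgroup H G" and cH: "card H = p ^ k" and E: "finite E"
    and closed: "\<And>h e. h \<in> H \<Longrightarrow> e \<in> E \<Longrightarrow> act h e \<in> E"
    and one: "\<And>e. e \<in> E \<Longrightarrow> act \<one> e = e"
    and comp: "\<And>h h' e. h \<in> H \<Longrightarrow> h' \<in> H \<Longrightarrow> e \<in> E \<Longrightarrow> act (h \<otimes> h') e = act h (act h' e)"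
  shows "[card {e \<in> E. \<forall>h\<in>H. act h e = e} = card E] (mod p)"
proof -
  define K where "K = G\<lparr>carrier := H\<rparr>"
  define \<phi> where "\<phi> = (\<lambda>h. \<lambda>e\<in>E. act h e)"
  have gK: "group K" unfolding K_def by (rule subgroup.subgroup_is_group[OF H is_group])
  have inv_mem: "inv h \<in> H" "h \<in> carrier G" if "h \<in> H" for h
    using that subgroup.m_inv_closed[OF H] subgroup.mem_carrier[OF H] by auto
  have inv_act: "act (inv h) (act h e) = e" "act h (act (inv h) e) = e" if "h \<in> H" "e \<in> E" for h e
    using that inv_mem[OF that(1)] comp[of "inv h" h e] comp[of h "inv h" e] one by simp_all
  have Bij: "\<phi> h \<in> Bij E" if "h \<in> H" for h
  proof -
    have "bij_betw (act h) E E"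
      by (rule bij_betw_byWitness[where f' = "act (inv h)"]) (use that closed inv_act inv_mem in auto)
    then show ?thesis unfolding Bij_def \<phi>_def by (auto simp: bij_betw_restrict_eq)
  qed
  have hom: "\<phi> \<in> hom K (BijGroup E)"
  proof (rule homI)
    show "\<phi> h \<in> carrier (BijGroup E)" if "h \<in> carrier K" for h
      using that Bij unfolding K_def BijGroup_def by simp
    fix h h' assume "h \<in> carrier K" "h' \<in> carrier K"
    then have h: "h \<in> H" "h' \<in> H" unfolding K_def by simp_all
    have "\<phi> (h \<otimes> h') = compose E (\<phi> h) (\<phi> h')"
      unfolding \<phi>_def compose_def by (rule restrict_ext) (use h comp closed in auto)
    then show "\<phi> (h \<otimes>\<^bsub>K\<^esub> h') = \<phi> h \<otimes>\<^bsub>BijGroup E\<^esub> \<phi> h'"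
      using Bij h unfolding K_def BijGroup_def by simp
  qed
  interpret A: group_action K E \<phi>
    by (rule group_action.intro) (use gK group_BijGroup hom in \<open>auto simp: group_hom_def group_hom_axioms_def\<close>)
  have orb: "orbit K \<phi> e = {act h e | h. h \<in> H}" if "e \<in> E" for e
    unfolding orbit_def K_def \<phi>_def using that by auto
  define F where "F = {e \<in> E. \<forall>h\<in>H. act h e = e}"
  have p_dvd: "p dvd card (orbit K \<phi> e)" if e: "e \<in> E - F" for e
  proof -
    have eE: "e \<in> E" using e by simp
    have "order K = p ^ k" using cH by (simp add: K_def order_def)
    then have "card (orbit K \<phi> e) dvd p ^ k"
      using A.orbit_stabilizer_theorem[OF eE] dvd_triv_left by metis
    then obtain i where i: "card (orbit K \<phi> e) = p ^ i" unfolding divides_primepow_nat[OF p] by blast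
    have "i \<noteq> 0"
    proof
      assume "i = 0"
      then have "card (orbit K \<phi> e) = 1" using i by simp
      then obtain a where a: "orbit K \<phi> e = {a}" by (rule card_1_singletonE)
      have "act h e = e" if "h \<in> H" for h
      proof -
        have "act h e \<in> orbit K \<phi> e" "e \<in> orbit K \<phi> e" using orb[OF eE] that A.orbit_refl[OF eE] by auto
        then show ?thesis using a by simp
      qed
      then show False using e F_def by auto
    qed
    then show ?thesis using i by (simp add: dvd_power)
  qed
  define C where "C = orbit K \<phi> ` (E - F)"
  have union: "\<Union>C = E - F"
  proof
    show "E - F \<subseteq> \<Union>C" unfolding C_def using A.orbit_refl by auto
    show "\<Union>C \<subseteq> E - F"
    proof
      fix y assume "y \<in> \<Union>C"
      then obtain e h where e: "e \<in> E" "e \<notin> F" "h \<in> H" "y = act h e" unfolding C_def using orb by auto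
      have "y \<in> E" using e closed by simp
      moreover have "y \<notin> F"
      proof
        assume "y \<in> F"
        then have "act (inv h) y = y" using e inv_mem F_def by auto
        then have "e = y" using inv_act e by simp
        then show False using \<open>y \<in> F\<close> e by simp
      qed
      ultimately show "y \<in> E - F" by simp
    qed
  qed
  have "p dvd card (\<Union>C)"
  proof (rule dvd_partition)
    show "finite (\<Union>C)" using union E by simp
    show "\<forall>c\<in>C. p dvd card c" unfolding C_def using p_dvd by auto
    show "\<forall>c1\<in>C. \<forall>c2\<in>C. c1 \<noteq> c2 \<longrightarrow> c1 \<inter> c2 = {}"
      using A.disjoint_union unfolding C_def orbits_def by blast
  qed
  then have "p dvd card (E - F)" using union by simp
  moreover have "card E = card F + card (E - F)"
    using E F_def by (metis (no_types, lifting) card_Diff_subset card_mono finite_subset le_add_diff_inverse mem_Collect_eq subsetI)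
  ultimately have "[card F = card E] (mod p)" by (metis cong_0_iff cong_add_lcancel_0_nat cong_sym)
  then show ?thesis unfolding F_def .
qed

section \<open>Sylow conjugacy and growth of normalisers by counting fixed cosets\<close>

context finite_group
begin

lemma finite_subgroup: "subgroup H G \<Longrightarrow> finite H"
  using finite_carrier finite_subset subgroup.subset by metis

text \<open>The inverse in \<open>C #> inv h\<close> turns right multiplication of cosets into a
  left action of H.\<close>

lemma card_cosets_fixed:
  assumes p: "Factorial_Ring.prime p" and H: "subgroup H G" "card H = p ^ k"
    and S: "subgroup S G" and T: "subgroup T G" and HT: "H \<subseteq> T"  and ST: "S \<subseteq> T"
  shows "[card {C \<in> (\<lambda>g. S #> g) ` T. \<forall>h\<in>H. C #> inv h = C} = card ((\<lambda>g. S #> g) ` T)] (mod p)"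
proof (rule p_group_fixed_points[OF p H])
  note mem = subgroup.mem_carrier[OF T] and memH = subgroup.mem_carrier[OF H(1)]
  have Ssub: "S \<subseteq> carrier G" using subgroup.subset[OF S] .
  show "finite ((\<lambda>g. S #> g) ` T)" using finite_subgroup[OF T] by simp
  show "C #> inv h \<in> (\<lambda>g. S #> g) ` T" if "h \<in> H" and C: "C \<in> (\<lambda>g. S #> g) ` T" for h C
  proof -
    obtain g where g: "g \<in> T" "C = S #> g" using C by auto
    then have "C #> inv h = S #> (g \<otimes> inv h)" using Ssub mem memH that by (simp add: coset_mult_assoc)
    moreover have "g \<otimes> inv h \<in> T" using g that HT subgroup.m_closed[OF T] subgroup.m_inv_closed[OF T] by blast
    ultimately show ?thesis by blast
  qed
  show "C #> inv \<one> = C" if "C \<in> (\<lambda>g. S #> g) ` T" for C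
    using that Ssub mem by (auto simp: coset_mult_assoc)
  show "C #> inv (h \<otimes> h') = (C #> inv h') #> inv h"
    if "h \<in> H" "h' \<in> H" "C \<in> (\<lambda>g. S #> g) ` T" for h h' C
    using that Ssub mem memH by (auto simp: coset_mult_assoc inv_mult_group m_assoc)
qed

lemma card_cosets_mult:
  assumes S: "subgroup S G" and T: "subgroup T G" and ST: "S \<subseteq> T"
  shows "card ((\<lambda>g. S #> g) ` T) * card S = card T"
proof -
  interpret T: group "G\<lparr>carrier := T\<rparr>" by (rule subgroup.subgroup_is_group[OF T is_group])
  have "subgroup S (G\<lparr>carrier := T\<rparr>)" using S T ST subgroup_incl by blast
  moreover have "rcosets\<^bsub>G\<lparr>carrier := T\<rparr>\<^esub> S = (\<lambda>g. S #> g) ` T"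
    by (auto simp: RCOSETS_def r_coset_def)
  ultimately show ?thesis using T.lagrange[of S] by (simp add: order_def)
qed

lemma coset_fixed_imp_conj:
  assumes S: "subgroup S G" and g: "g \<in> carrier G" and h: "h \<in> carrier G" and "(S #> g) #> inv h = S #> g"
  shows "g \<otimes> h \<otimes> inv g \<in> S"
proof -
  have "g \<in> S #> g" using S g by (simp add: rcos_self)
  moreover have "S #> g = S #> (g \<otimes> inv h)" using assms subgroup.subset[OF S] by (simp add: coset_mult_assoc)
  ultimately obtain s where s: "s \<in> S" "g = s \<otimes> (g \<otimes> inv h)" unfolding r_coset_def by auto
  have sc: "s \<in> carrier G" using s S subgroup.mem_carrier by metis
  have "g \<otimes> h \<otimes> inv g = s \<otimes> (g \<otimes> inv h) \<otimes> h \<otimes> inv g" using s(2) by simp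
  also have "\<dots> = s" using sc g h by (simp add: m_assoc)
  finally show ?thesis using s by simp
qed

text \<open>Sylow's argument: the number of cosets of S is prime to p, so H fixes one of them, S g,
  and then g conjugates H into S.\<close>

lemma p_subgroup_conj_into:
  assumes p: "Factorial_Ring.prime p" and H: "subgroup H G" "card H = p ^ k"
    and S: "subgroup S G" and index: "\<not> p dvd order G div card S"
  obtains g where "g \<in> carrier G" "\<And>h. h \<in> H \<Longrightarrow> g \<otimes> h \<otimes> inv g \<in> S"
proof -
  let ?E = "(\<lambda>g. S #> g) ` carrier G"
  have "card ?E * card S = order G" using card_cosets_mult[OF S subgroup_self] subgroup.subset[OF S] by (simp add: order_def)
  moreover have "card S > 0" using S finite_subgroup subgroup.one_closed by (metis card_gt_0_iff empty_iff)
  ultimately have "\<not> p dvd card ?E" using index by (metis nonzero_mult_div_cancel_right less_numeral_extra(3))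
  moreover have "[card {C \<in> ?E. \<forall>h\<in>H. C #> inv h = C} = card ?E] (mod p)"
    using card_cosets_fixed[OF p H S subgroup_self] H S by (simp add: subgroup.subset)
  ultimately have "card {C \<in> ?E. \<forall>h\<in>H. C #> inv h = C} \<noteq> 0"
    by (metis cong_0_iff cong_sym_eq)
  then have "{C \<in> ?E. \<forall>h\<in>H. C #> inv h = C} \<noteq> {}" by (intro notI) (simp only: card.empty)
  then obtain C where "C \<in> ?E" "\<forall>h\<in>H. C #> inv h = C" by blast
  then show thesis using that coset_fixed_imp_conj[OF S] subgroup.mem_carrier[OF H(1)] by auto
qed

text \<open>S acts on its own cosets in T. Their number is a power of p other than 1 and the coset S
  is fixed, so a second coset S g is fixed as well, and g conjugates S into itself.\<close>

lemma p_group_normalizer_grows: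
  assumes p: "Factorial_Ring.prime p" and T: "subgroup T G" "card T = p ^ k"
    and S: "subgroup S G" and ST: "S \<subset> T"
  obtains g where "g \<in> T" "g \<notin> S" "\<And>h. h \<in> S \<Longrightarrow> g \<otimes> h \<otimes> inv g \<in> S"
proof -
  let ?E = "(\<lambda>g. S #> g) ` T"
  let ?F = "{C \<in> ?E. \<forall>h\<in>S. C #> inv h = C}"
  have sub: "S \<subseteq> T" using ST by simp
  have E: "card ?E * card S = card T" using card_cosets_mult[OF S T(1) sub] .
  have lt: "card S < card T" using ST finite_subgroup[OF T(1)] psubset_card_mono by blast
  obtain l where l: "card S = p ^ l" using E T(2) divides_primepow_nat[OF p] by (metis dvd_triv_right)
  obtain m where m: "card ?E = p ^ m" using E T(2) divides_primepow_nat[OF p] by (metis dvd_triv_left)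
  have "m \<noteq> 0" using m E lt by (metis mult_1 nat_neq_iff power_0)
  then have "p dvd card ?E" using m by (simp add: dvd_power)
  then have pF: "p dvd card ?F"
    using card_cosets_fixed[OF p S l S T(1) sub sub] by (simp add: cong_dvd_iff)
  have SF: "S \<in> ?F"
  proof -
    have "S = S #> \<one>" using subgroup.subset[OF S] by simp
    then have "S \<in> ?E" using subgroup.one_closed[OF T(1)] by blast
    moreover have "S #> inv h = S" if "h \<in> S" for h
      using that S by (simp add: coset_join2 subgroup.m_inv_closed subgroup.mem_carrier)
    ultimately show ?thesis by blast
  qed
  have "?F \<noteq> {S}"
  proof
    assume "?F = {S}"
    then have "card ?F = 1" by simp
    then show False using pF p by (metis nat_dvd_1_iff_1 not_prime_1)
  qed
  then obtain C where C: "C \<in> ?F" "C \<noteq> S" using SF by blast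
  then obtain g where g: "g \<in> T" "C = S #> g" by auto
  have gc: "g \<in> carrier G" using g T subgroup.mem_carrier by metis
  have "g \<notin> S" using C(2) g(2) gc S coset_join2 by metis
  moreover have "g \<otimes> h \<otimes> inv g \<in> S" if "h \<in> S" for h
    by (rule coset_fixed_imp_conj[OF S gc]) (use that C g subgroup.mem_carrier[OF S] in \<open>auto\<close>)
  ultimately show thesis using that g by blast
qed

end

section \<open>A criterion for p-groups to be cyclic\<close>

text \<open>By Fermat r^p = r modulo p. This is applied to the exponent r with which an element x
  acts on a cyclic p-group when x^p acts trivially.\<close>

lemma cong_1_of_pow_prime_cong_1:
  fixes r p :: nat
  assumes p: "Factorial_Ring.prime p" and r: "[r ^ p = 1] (mod p)"
  shows "[r = 1] (mod p)"
proof -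
  have "coprime (r ^ p) p" using r by (metis cong_imp_coprime cong_sym coprime_1_left)
  then have cop: "coprime r p" using prime_gt_0_nat[OF p] by simp
  have "\<not> p dvd r"
  proof
    assume "p dvd r"
    then have "p = 1" using coprime_common_divisor_nat[OF cop] by simp
    then show False using p by simp
  qed
  then have "[r ^ (p - 1) = 1] (mod p)" using fermat_theorem p by simp
  then have "[r * r ^ (p - 1) = r * 1] (mod p)" by (rule cong_scalar_left)
  moreover have "r * r ^ (p - 1) = r ^ p" using p by (metis power_eq_if prime_gt_0_nat less_numeral_extra(3))
  ultimately show ?thesis using r by (metis cong_sym cong_trans mult.right_neutral)
qed

context finite_group
begin

lemma ord_dvd_subgroup:
  assumes "subgroup T G" "x \<in> T"
  shows "ord x dvd card T"
proof -
  interpret T: group "G\<lparr>carrier := T\<rparr>" by (rule subgroup.subgroup_is_group[OF assms(1) is_group])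
  have "x [^] card T = \<one>"
    using T.pow_order_eq_1[of x] assms(2) by (simp add: order_def flip: nat_pow_consistent)
  then show ?thesis using pow_eq_id subgroup.mem_carrier[OF assms] by simp
qed

lemma subgroup_pow_closed: "subgroup T G \<Longrightarrow> x \<in> T \<Longrightarrow> x [^] (k::nat) \<in> T"
  by (induction k) (auto simp: subgroup.one_closed subgroup.m_closed)

lemma exists_torsion_translate:
  assumes p: "Factorial_Ring.prime p" and x: "x \<in> carrier G" and d: "d \<in> carrier G"
    and r: "x \<otimes> d = d [^] (r::nat) \<otimes> x" and r1: "[r = 1] (mod p)" and two: "p = 2 \<Longrightarrow> [r = 1] (mod 4)"
    and xp: "x [^] p = d [^] (p * j)" and od: "ord d = p ^ e"
  obtains i :: nat where "(d [^] i \<otimes> x) [^] p = \<one>"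
proof -
  obtain w where w: "(\<Sum>t<p. r ^ t) = p * w" "coprime w p"
    using sum_powers_eq_prime_times_unit[OF p r1 two] by blast
  have "coprime w (p ^ e)" using w(2) by simp
  then obtain u where u: "[w * u = 1] (mod p ^ e)" using cong_solve_coprime_nat[of w "p ^ e"] by auto
  \<comment> \<open>\<open>u\<close> inverts w modulo p^e and \<open>p ^ e - 1\<close> stands for
    -1, so i is -j / w. This makes i w + j vanish in (d^i x)^p = d^(p (i w + j)).\<close>
  define i where "i = u * (j * (p ^ e - 1))"
  have "[i * w + j = 1 * (j * (p ^ e - 1)) + j] (mod p ^ e)"
  proof -
    have "i * w = (w * u) * (j * (p ^ e - 1))" unfolding i_def by (simp only: ac_simps)
    then show ?thesis using cong_add[OF cong_mult[OF u cong_refl] cong_refl] by metis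
  qed
  also have "1 * (j * (p ^ e - 1)) + j = j * p ^ e"
    using prime_gt_0_nat[OF p] by (simp add: algebra_simps)
  finally have "p ^ e dvd i * w + j" using cong_dvd_iff by (metis dvd_triv_right)
  then have dvd: "p ^ e dvd p * (i * w + j)" by (rule dvd_mult)
  have "(d [^] i \<otimes> x) [^] p = d [^] (i * (p * w)) \<otimes> x [^] p"
    using mult_pow_of_conj[OF x d r] w by simp
  also have "\<dots> = d [^] (p * (i * w + j))"
    unfolding xp using d by (simp add: nat_pow_mult algebra_simps)
  also have "\<dots> = \<one>" using dvd d od pow_eq_id by simp
  finally show thesis by (rule that)
qed

text \<open>Among the cyclic subgroups containing \<open>c\<close>, let \<open>D\<close> be one of maximal order. If \<open>D \<noteq> T\<close>, some
  \<open>x \<notin> D\<close> normalises \<open>D\<close> and has \<open>x^p \<in> D\<close>; by maximality \<open>x^p\<close> is a \<open>p\<close>-th power in \<open>D\<close>, so the coset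
  \<open>D x\<close> contains an element killed by \<open>p\<close>, which then lies in \<open>\<langle>c\<rangle> \<subseteq> D\<close>.\<close>

lemma cyclic_of_torsion:
  assumes p: "Factorial_Ring.prime p" and T: "subgroup T G" "card T = p ^ n"
    and c: "c \<in> T" "c \<noteq> \<one>"
    and tors: "\<And>y. y \<in> T \<Longrightarrow> y [^] p = \<one> \<Longrightarrow> y \<in> generate G {c}"
    and two: "p = 2 \<Longrightarrow> 4 dvd ord c" "\<And>y. p = 2 \<Longrightarrow> y \<in> T \<Longrightarrow> y \<otimes> c = c \<otimes> y"
  obtains d where "d \<in> T" "generate G {d} = T"
proof -
  note TG = subgroup.mem_carrier[OF T(1)]
  have cG: "c \<in> carrier G" using c TG by simp
  let ?Q = "\<lambda>d. d \<in> T \<and> c \<in> generate G {d}"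
  have "?Q c" using c generate_self[OF cG] by simp
  moreover have "\<forall>y. ?Q y \<longrightarrow> ord y < Suc (order G)"
    using TG ord_le_group_order[OF finite_carrier] by (auto simp: less_Suc_eq_le)
  ultimately obtain d where d: "?Q d" and max: "\<And>y. ?Q y \<Longrightarrow> ord y \<le> ord d"
    using ex_has_greatest_nat[of ?Q c ord "Suc (order G)"] by blast
  define D where "D = generate G {d}"
  have dT: "d \<in> T" and dG: "d \<in> carrier G" and cD: "c \<in> D" using d TG D_def by auto
  have DT: "D \<subseteq> T" unfolding D_def by (rule generate_in_subgroup[OF T(1) dT])
  have Dsub: "subgroup D G" unfolding D_def by (rule generate_is_subgroup) (use dG in simp)
  have dD: "d \<in> D" unfolding D_def using dG by (rule generate_self)
  have ppow: "\<exists>e. ord y = p ^ e" if "y \<in> T" for y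
    using ord_dvd_subgroup[OF T(1) that] T(2) divides_primepow_nat[OF p] by auto
  obtain e where e: "ord d = p ^ e" using ppow dT by blast
  have "d \<noteq> \<one>"
  proof
    assume "d = \<one>"
    then have "c = \<one>" using cD in_generate_iff[OF dG] unfolding D_def by auto
    then show False using c by simp
  qed
  then have "e \<noteq> 0" using e ord_eq_1[OF dG] by auto
  then have pd: "p dvd ord d" using e by (simp add: dvd_power)
  have "D = T"
  proof (rule ccontr)
    assume "D \<noteq> T"
    then have "D \<subset> T" using DT by blast
    then obtain g where g: "g \<in> T" "g \<notin> D" and norm: "\<And>h. h \<in> D \<Longrightarrow> g \<otimes> h \<otimes> inv g \<in> D"
      using p_group_normalizer_grows[OF p T Dsub] by blast
    have gG: "g \<in> carrier G" using g TG by simp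
    have normk: "g [^] k \<otimes> d \<otimes> inv (g [^] k) \<in> D" for k :: nat
    proof (induction k)
      case (Suc k)
      have sh: "g [^] Suc k = g \<otimes> g [^] k" using gG by (metis nat_pow_Suc2)
      have "g [^] Suc k \<otimes> d \<otimes> inv (g [^] Suc k) = g \<otimes> (g [^] k \<otimes> d \<otimes> inv (g [^] k)) \<otimes> inv g"
        unfolding sh using gG dG by (simp add: inv_mult_group m_assoc)
      then show ?case using norm Suc by simp
    qed (use dG dD in simp)
    obtain f where "ord g = p ^ f" using ppow g by blast
    then have "g [^] (p ^ f) \<in> D" using subgroup.one_closed[OF Dsub] gG pow_ord_eq_1 by metis
    then have "\<exists>t. g [^] (p ^ t) \<in> D" ..
    \<comment> \<open>The last of the powers g^(p^s) outside D still normalises D, by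
      \<open>normk\<close>, and its p-th power lies in D.\<close>
    define t where "t = (LEAST t. g [^] (p ^ t) \<in> D)"
    have t: "g [^] (p ^ t) \<in> D" unfolding t_def by (rule LeastI_ex) fact
    have "t \<noteq> 0" using t g(2) gG by (metis nat_pow_eone power_0)
    then obtain s where s: "t = Suc s" using not0_implies_Suc by blast
    define x where "x = g [^] (p ^ s)"
    have xD: "x \<notin> D" using not_less_Least[of s "\<lambda>t. g [^] (p ^ t) \<in> D"] s unfolding x_def t_def by simp
    have xpD: "x [^] p \<in> D" using t s gG unfolding x_def by (simp add: nat_pow_pow mult.commute)
    have xT: "x \<in> T" unfolding x_def using subgroup_pow_closed[OF T(1)] g by blast
    have xG: "x \<in> carrier G" using xT TG by simp
    obtain r :: nat where "x \<otimes> d \<otimes> inv x = d [^] r"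
      using normk[of "p ^ s"] in_generate_iff[OF dG] unfolding x_def D_def by blast
    then have r: "x \<otimes> d = d [^] r \<otimes> x" using xG dG by (metis inv_solve_right m_closed nat_pow_closed)
    obtain m :: nat where m: "x [^] p = d [^] m" using xpD in_generate_iff[OF dG] unfolding D_def by blast
    \<comment> \<open>x^p lies in D and so commutes with d; comparing with the action of x^p gives
      r^p = 1 modulo \<open>ord d\<close>.\<close>
    have "d [^] (r ^ p) \<otimes> x [^] p = d \<otimes> x [^] p"
    proof -
      have "d [^] (r ^ p) \<otimes> x [^] p = x [^] p \<otimes> d" using pow_conj_pow[OF xG dG r] by simp
      also have "\<dots> = d \<otimes> x [^] p" unfolding m using dG nat_pow_comm[OF dG, of m 1] by simp
      finally show ?thesis .
    qed
    then have "d [^] (r ^ p) = d [^] (1::nat)" using dG xG by simp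
    then have "[r ^ p = 1] (mod ord d)" by (simp only: pow_cong[OF dG])
    then have "[r ^ p = 1] (mod p)" using pd by (rule cong_dvd_modulus_nat)
    then have r1: "[r = 1] (mod p)" by (rule cong_1_of_pow_prime_cong_1[OF p])
    \<comment> \<open>For p = 2 the exponent r is tested on c, which is a power of d and central in
      T: c^r = c, and 4 divides \<open>ord c\<close>. Without this a quaternion group with its
      central involution as c would pass.\<close>
    have r4: "[r = 1] (mod 4)" if "p = 2"
    proof -
      obtain q :: nat where q: "c = d [^] q" using cD in_generate_iff[OF dG] unfolding D_def by blast
      have "c \<otimes> x = x \<otimes> c" using two(2)[OF that xT] by simp
      also have "\<dots> = d [^] (q * r) \<otimes> x" unfolding q by (rule conj_pow[OF xG dG r])
      also have "d [^] (q * r) = c [^] r" unfolding q using dG by (simp add: nat_pow_pow)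
      finally have "c = c [^] r" using cG xG by simp
      then have "c [^] r = c [^] (1::nat)" using cG by simp
      then have "[r = 1] (mod ord c)" by (simp only: pow_cong[OF cG])
      then show ?thesis using two(1)[OF that] by (rule cong_dvd_modulus_nat)
    qed
    \<comment> \<open>Otherwise x^p generates D, and <x> is a cyclic subgroup containing c that is
      strictly larger than D.\<close>
    have "p dvd m"
    proof (rule ccontr)
      assume "\<not> p dvd m"
      then have "coprime m p" using p by (metis coprime_commute prime_imp_coprime)
      then have "coprime m (ord d)" using e by simp
      then have "d \<in> generate G {x [^] p}" using coprime_pow_generates[OF dG] m by simp
      then have dx: "d \<in> generate G {x}"
        using generate_mono_elem[OF xG pow_in_generate[OF xG]] by blast
      then have "c \<in> generate G {x}" using generate_mono_elem[OF xG] cD unfolding D_def by blast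
      then have "ord x \<le> ord d" using max xT by simp
      moreover have "ord d dvd ord x" using dx in_generate_iff[OF xG] xG 
        by (metis nat_pow_closed nat_pow_one nat_pow_pow mult.commute pow_eq_id pow_ord_eq_1)
      ultimately have "ord d = ord x" using ord_pos[OF xG] by (simp add: dvd_imp_le le_antisym)
      then have "generate G {d} = generate G {x}" using generate_eq_of_ord_eq[OF xG dx] by simp
      then show False using xD generate_self[OF xG] unfolding D_def by simp
    qed
    then obtain j where j: "m = p * j" by blast
    obtain i :: nat where i: "(d [^] i \<otimes> x) [^] p = \<one>"
      using exists_torsion_translate[OF p xG dG r r1 r4] m j e by metis
    have dD: "d [^] i \<in> D" unfolding D_def using pow_in_generate[OF dG] .
    have "d [^] i \<otimes> x \<in> T" using subgroup.m_closed[OF T(1)] dD DT xT by blast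
    then have "d [^] i \<otimes> x \<in> generate G {c}" using tors i by simp
    then have "d [^] i \<otimes> x \<in> D" using generate_mono_elem[OF dG] cD unfolding D_def by blast
    then have "inv (d [^] i) \<otimes> (d [^] i \<otimes> x) \<in> D"
      using dD subgroup.m_closed[OF Dsub] subgroup.m_inv_closed[OF Dsub] by blast
    then show False using xD xG dG by (simp flip: m_assoc)
  qed
  then show thesis using that dT D_def by blast
qed

end

section \<open>2-groups with a unique cyclic subgroup of some order\<close>

lemma lower_central_Suc:
  "1 \<le> i \<Longrightarrow> lower_central G (Suc i) = commutator_subgroup G (lower_central G i) (carrier G)"
  unfolding lower_central_def by (cases i) auto

context finite_group
begin

text \<open>As s = 3 modulo 4, s - 1 = 2 v with v odd. So taking commutators with an element outside
  D amounts to squaring in D, up to an odd exponent, and each further term of the lower central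
  series is half as large as the one before. Only s modulo 4 enters, so dihedral, semidihedral and
  quaternion groups are treated alike.\<close>

lemma maximal_class_of_index_2:
  assumes d: "d \<in> carrier G" and x: "x \<in> carrier G" and xD: "x \<notin> generate G {d}"
    and cover: "\<And>g. g \<in> carrier G \<Longrightarrow> g \<notin> generate G {d} \<Longrightarrow> \<exists>h\<in>generate G {d}. g = x \<otimes> h"
    and s: "x \<otimes> d = d [^] (s::nat) \<otimes> x" "[s = 3] (mod 4)"
    and e: "ord d = 2 ^ e" "2 \<le> e"
  shows "maximal_class_2_group G"
proof -
  define D where "D = generate G {d}"
  define comm where "comm h k = h \<otimes> k \<otimes> inv h \<otimes> inv k" for h k
  define E where "E i = generate G {d [^] (2 ^ i :: nat)}" for i
  have Dsub: "subgroup D G" unfolding D_def by (rule generate_is_subgroup) (use d in simp)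
  note DG = subgroup.mem_carrier[OF Dsub]
  have Esub: "subgroup (E i) G" for i unfolding E_def by (rule generate_is_subgroup) (use d in simp)
  have D_iff: "y \<in> D \<longleftrightarrow> (\<exists>a::nat. y = d [^] a)" for y unfolding D_def by (rule in_generate_iff[OF d])
  have E_iff: "y \<in> E i \<longleftrightarrow> (\<exists>a::nat. y = d [^] (2 ^ i * a))" for y i
    unfolding E_def using in_generate_iff[of "d [^] (2 ^ i :: nat)"] d by (simp add: nat_pow_pow)
  have Dcomm: "h \<otimes> k = k \<otimes> h" if "h \<in> D" "k \<in> D" for h k
    using that d D_iff by (auto simp: nat_pow_mult add.commute)
  have "s mod 4 = 3" using s(2) by (simp add: cong_def)
  then have "s = 1 + 2 * (2 * (s div 4) + 1)" by presburger
  then obtain v where v: "s = 1 + 2 * v" "odd v" by (metis even_plus_one_iff dvd_triv_left)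
  \<comment> \<open>Every element outside D is x u with u in D, and D is abelian, so all of them act
    on D as x does.\<close>
  have conjD: "k \<otimes> h = h [^] s \<otimes> k" if k: "k \<in> carrier G" "k \<notin> D" and h: "h \<in> D" for h k
  proof -
    obtain u where u: "u \<in> D" "k = x \<otimes> u" using cover[OF k(1)] k(2) unfolding D_def by blast
    obtain a :: nat where a: "h = d [^] a" using h D_iff by blast
    have "k \<otimes> h = x \<otimes> (u \<otimes> h)" using u x h DG by (simp add: m_assoc)
    also have "\<dots> = (x \<otimes> h) \<otimes> u" using Dcomm[OF u(1) h] u x h DG by (simp add: m_assoc)
    also have "x \<otimes> h = h [^] s \<otimes> x" unfolding a using conj_pow[OF x d s(1)] d by (simp add: nat_pow_pow)
    also have "h [^] s \<otimes> x \<otimes> u = h [^] s \<otimes> k" using u x h DG by (simp add: m_assoc)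
    finally show ?thesis .
  qed
  have comm_right: "comm k h = h [^] (2 * v)" if k: "k \<in> carrier G" "k \<notin> D" and h: "h \<in> D" for h k
  proof -
    have "comm k h = h [^] s \<otimes> inv h"
      unfolding comm_def conjD[OF k h] using k h DG by (simp add: m_assoc)
    also have "\<dots> = h [^] (2 * v) \<otimes> h \<otimes> inv h" unfolding v(1) by simp
    also have "\<dots> = h [^] (2 * v)" using h DG by (simp add: m_assoc)
    finally show ?thesis .
  qed
  have comm_inv: "comm h k = inv (comm k h)" if "h \<in> carrier G" "k \<in> carrier G" for h k
    unfolding comm_def using that by (simp add: inv_mult_group m_assoc)
  have comm_D: "comm h k = \<one>" if "h \<in> D" "k \<in> D" for h k
    unfolding comm_def Dcomm[OF that] using that DG by (simp add: m_assoc)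
  have pow_E: "h [^] (2 * v) \<in> E (Suc i)" if "h = d [^] (2 ^ i * a)" for h i and a :: nat
  proof -
    have "h [^] (2 * v) = d [^] (2 ^ Suc i * (a * v))" unfolding that using d by (simp add: nat_pow_pow ac_simps)
    then show ?thesis using E_iff by blast
  qed
  have comm_E: "comm h k \<in> E (Suc i)" if h: "h = d [^] (2 ^ i * a)" and k: "k \<in> carrier G" for h i k and a :: nat
  proof (cases "k \<in> D")
    case True
    then show ?thesis using comm_D h D_iff subgroup.one_closed[OF Esub] by metis
  next
    case False
    have "h \<in> D" using h D_iff by blast
    then show ?thesis using comm_inv[OF DG k] comm_right[OF k False] pow_E[OF h] subgroup.m_inv_closed[OF Esub] by metis
  qed
  have comm_1: "comm h k \<in> E 1" if h: "h \<in> carrier G" and k: "k \<in> carrier G" for h k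
  proof (cases "h \<in> D")
    case True
    then obtain a :: nat where "h = d [^] (2 ^ 0 * a)" using D_iff by auto
    then show ?thesis using comm_E[OF _ k] by (metis One_nat_def)
  next
    case hD: False
    show ?thesis
    proof (cases "k \<in> D")
      case True
      then obtain a :: nat where a: "k = d [^] (2 ^ 0 * a)" using D_iff by auto
      show ?thesis using comm_right[OF h hD True] pow_E[OF a] by simp
    next
      case False
      obtain a b where ab: "a \<in> D" "b \<in> D" "h = x \<otimes> a" "k = x \<otimes> b"
        using cover[OF h] cover[OF k] hD False unfolding D_def by blast
      \<comment> \<open>For two elements outside D write k = h u with u in D; then [h, h u] = h
        [h, u] h^-1 leads back to the case of one element in D.\<close>
      define u where "u = inv a \<otimes> b"
      have u: "u \<in> D" unfolding u_def using ab subgroup.m_closed[OF Dsub] subgroup.m_inv_closed[OF Dsub] by blast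
      have uG: "u \<in> carrier G" using u DG by simp
      have "a \<otimes> u = b" unfolding u_def using ab(1,2) DG by (simp flip: m_assoc)
      then have ku: "k = h \<otimes> u" unfolding ab(3,4) using ab(1) DG uG x by (simp add: m_assoc)
      have "comm h k = h \<otimes> comm h u \<otimes> inv h"
        unfolding comm_def ku using h uG by (simp add: m_assoc inv_mult_group)
      also have "\<dots> = h \<otimes> u [^] (2 * v) \<otimes> inv h" using comm_right[OF h hD u] by simp
      also have "\<dots> = (u [^] (2 * v)) [^] s \<otimes> h \<otimes> inv h"
        using conjD[OF h hD] subgroup_pow_closed[OF Dsub u] by simp
      also have "\<dots> = (u [^] (2 * v)) [^] s" using uG h by (simp add: m_assoc)
      also have "\<dots> \<in> E 1"
      proof -
        obtain a :: nat where "u = d [^] (2 ^ 0 * a)" using u D_iff by auto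
        then have "u [^] (2 * v) \<in> E 1" using pow_E by (metis One_nat_def)
        then show ?thesis by (rule subgroup_pow_closed[OF Esub])
      qed
      finally show ?thesis .
    qed
  qed
  \<comment> \<open>For the reverse inclusion one commutator suffices: for h = d^(2^i) the
    commutator [x, h] is (d^(2^(i+1)))^v, which generates \<open>E (Suc i)\<close> because v is
    odd.\<close>
  have step: "commutator_subgroup G L (carrier G) = E (Suc i)"
    if L: "L \<subseteq> carrier G" "d [^] (2 ^ i :: nat) \<in> L" "\<And>h k. h \<in> L \<Longrightarrow> k \<in> carrier G \<Longrightarrow> comm h k \<in> E (Suc i)" for L i
  proof -
    define W where "W = (\<Union>h\<in>L. \<Union>k\<in>carrier G. {comm h k})"
    have XE: "W \<subseteq> E (Suc i)" unfolding W_def using L(3) by blast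
    have XG: "W \<subseteq> carrier G" using XE subgroup.subset[OF Esub] by blast
    have gX: "subgroup (generate G W) G" by (rule generate_is_subgroup[OF XG])
    have "commutator_subgroup G L (carrier G) = generate G W"
      unfolding commutator_subgroup_def W_def comm_def ..
    also have "generate G W = E (Suc i)"
    proof
      show "generate G W \<subseteq> E (Suc i)" by (rule generate_subgroup_incl[OF XE Esub])
      define h where "h = d [^] (2 ^ i :: nat)"
      have hD: "h \<in> D" "h \<in> carrier G" using h_def D_iff d by auto
      have "comm h x \<in> generate G W" unfolding W_def by (rule generate.incl) (use L(2) x h_def in blast)
      then have "h [^] (2 * v) \<in> generate G W"
        using comm_inv[OF x hD(2)] comm_right[OF x xD[folded D_def] hD(1)] subgroup.m_inv_closed[OF gX] by metis
      moreover have "h [^] (2 * v) = (d [^] (2 ^ Suc i :: nat)) [^] v"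
        unfolding h_def using d by (simp add: nat_pow_pow ac_simps)
      moreover have "d [^] (2 ^ Suc i :: nat) \<in> generate G {(d [^] (2 ^ Suc i :: nat)) [^] v}"
      proof (rule coprime_pow_generates)
        have "(d [^] (2 ^ Suc i :: nat)) [^] ord d = \<one>"
          using d by (metis nat_pow_pow mult.commute nat_pow_one pow_ord_eq_1)
        then have "ord (d [^] (2 ^ Suc i :: nat)) dvd 2 ^ e" using d e pow_eq_id by simp
        moreover have "coprime v (2 ^ e)" using v(2) by simp
        ultimately show "coprime v (ord (d [^] (2 ^ Suc i :: nat)))" using coprime_divisors dvd_refl by blast
      qed (use d in simp)
      ultimately have "d [^] (2 ^ Suc i :: nat) \<in> generate G W" using generate_in_subgroup[OF gX] by auto
      then show "E (Suc i) \<subseteq> generate G W" unfolding E_def by (rule generate_in_subgroup[OF gX])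
    qed
    finally show ?thesis .
  qed
  \<comment> \<open>The first term is the whole group and not \<open>E 0\<close>, which is D; the
    pattern starts with the second term.\<close>
  have lc: "lower_central G (Suc (Suc i)) = E (Suc i)" for i
  proof (induction i)
    case 0
    have "lower_central G (Suc 0) = carrier G" unfolding lower_central_def by simp
    then show ?case using lower_central_Suc[of "Suc 0" G] step[of "carrier G" 0] comm_1 d by simp
  next
    case (Suc i)
    have "commutator_subgroup G (E (Suc i)) (carrier G) = E (Suc (Suc i))"
    proof (rule step)
      show "E (Suc i) \<subseteq> carrier G" by (rule subgroup.subset[OF Esub])
      show "d [^] (2 ^ Suc i :: nat) \<in> E (Suc i)" unfolding E_def by (rule generate_self) (use d in simp)
      show "comm h k \<in> E (Suc (Suc i))" if "h \<in> E (Suc i)" "k \<in> carrier G" for h k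
        using that comm_E E_iff by metis
    qed
    then show ?case using lower_central_Suc[of "Suc (Suc i)" G] Suc by simp
  qed
  \<comment> \<open>The order will be 2^(e+1), so maximal class concerns the terms e and e + 1 of
    the series. These are E (e - 1), written \<open>E (Suc f)\<close>, and
    \<open>E e\<close>.\<close>
  obtain f where f: "e = Suc (Suc f)" using e(2) by (metis add_2_eq_Suc le_Suc_ex)
  have "E e = {\<one>}"
  proof -
    have "d [^] (2 ^ e :: nat) = \<one>" using e d pow_ord_eq_1 by metis
    then show ?thesis unfolding E_def using generate_one by simp
  qed
  moreover have "E (Suc f) \<noteq> {\<one>}"
  proof
    assume "E (Suc f) = {\<one>}"
    moreover have "d [^] (2 ^ Suc f :: nat) \<in> E (Suc f)" unfolding E_def by (rule generate_self) (use d in simp)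
    ultimately have "ord d dvd 2 ^ Suc f" using pow_eq_id[OF d] by simp
    then show False using e f power_dvd_imp_le[of 2 e "Suc f"] by simp
  qed
  moreover have "order G = 2 ^ Suc e"
  proof -
    have "carrier G = D \<union> (\<lambda>h. x \<otimes> h) ` D" using cover x DG unfolding D_def by blast
    moreover have "D \<inter> (\<lambda>h. x \<otimes> h) ` D = {}"
    proof -
      have "x \<in> D" if "x \<otimes> h \<in> D" "h \<in> D" for h
      proof -
        have "x \<otimes> h \<otimes> inv h \<in> D" using that subgroup.m_closed[OF Dsub] subgroup.m_inv_closed[OF Dsub] by blast
        then show ?thesis using x that DG by (simp add: m_assoc)
      qed
      then show ?thesis using xD unfolding D_def by blast
    qed
    moreover have "card ((\<lambda>h. x \<otimes> h) ` D) = card D"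
      by (rule card_image) (use x DG in \<open>auto simp: inj_on_def\<close>)
    moreover have "card D = 2 ^ e" unfolding D_def using card_generate[OF d] e by simp
    moreover have "finite D" by (rule finite_subgroup[OF Dsub])
    ultimately show ?thesis unfolding order_def by (simp add: card_Un_disjoint)
  qed
  moreover have "\<not> cyclic_group G"
  proof
    assume "cyclic_group G"
    then interpret comm_group G by (rule cyclic_imp_abelian_group)
    have "d [^] s \<otimes> x = d \<otimes> x" using s(1) m_comm[OF x d] by simp
    then have "d [^] s = d [^] (1::nat)" using x d by simp
    then have "[s = 1] (mod 2 ^ e)" by (simp only: pow_cong[OF d] e)
    moreover have "(4::nat) dvd 2 ^ e" unfolding f by simp
    ultimately have "[s = 1] (mod 4)" by (rule cong_dvd_modulus_nat)
    then show False using s(2) by (simp add: cong_def)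
  qed
  moreover have "lower_central G (Suc e - 1) = E (Suc f)" "lower_central G (Suc e) = E e" using lc[of f] lc[of "Suc f"] f by simp_all
  ultimately show ?thesis unfolding maximal_class_2_group_def
    using is_group e(2) by (intro conjI exI[of _ "Suc e"]) simp_all
qed

end

lemma (in group) cancel_inv_left:
  assumes "g \<in> carrier G" "y \<in> carrier G"
  shows "inv g \<otimes> (g \<otimes> y) = y" "g \<otimes> (inv g \<otimes> y) = y"
  using assms by (simp_all flip: m_assoc)

context finite_group
begin

lemma cyclic_groupI:
  assumes "d \<in> carrier G" "generate G {d} = carrier G"
  shows "cyclic_group G"
proof -
  have "subgroup_generated G {d} = G" unfolding subgroup_generated_def using assms by simp
  then show ?thesis unfolding cyclic_group_def using assms(1) by blast
qed

lemma conj_nat_pow: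
  assumes "g \<in> carrier G" "x \<in> carrier G"
  shows "(g \<otimes> x \<otimes> inv g) [^] (n::nat) = g \<otimes> x [^] n \<otimes> inv g"
proof (induction n)
  case (Suc n)
  have "(g \<otimes> x \<otimes> inv g) [^] Suc n = (g \<otimes> x [^] n \<otimes> inv g) \<otimes> (g \<otimes> x \<otimes> inv g)"
    using Suc by simp
  then show ?case using assms by (simp add: m_assoc cancel_inv_left)
qed (use assms in simp)

lemma ord_conj:
  assumes "g \<in> carrier G" "x \<in> carrier G"
  shows "ord (g \<otimes> x \<otimes> inv g) = ord x"
proof -
  have "(g \<otimes> x \<otimes> inv g) [^] n = \<one> \<longleftrightarrow> x [^] n = \<one>" for n :: nat
  proof -
    have "g \<otimes> x [^] n \<otimes> inv g = \<one> \<longleftrightarrow> g \<otimes> x [^] n = g" using assms by (metis inv_closed inv_inv inv_solve_right l_one m_closed nat_pow_closed one_closed r_inv r_one)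
    then show ?thesis using assms conj_nat_pow by simp
  qed
  then show ?thesis using assms ord_unique pow_eq_id by (metis inv_closed m_closed)
qed

lemma conj_eq_pow:
  assumes "g \<in> carrier G" "c \<in> carrier G" "g \<otimes> c \<otimes> inv g \<in> generate G {c}"
  obtains r :: nat where "g \<otimes> c = c [^] r \<otimes> g"
proof -
  obtain r :: nat where "g \<otimes> c \<otimes> inv g = c [^] r" using assms in_generate_iff by blast
  then have "g \<otimes> c = c [^] r \<otimes> g" using assms by (metis inv_solve_right m_closed nat_pow_closed)
  then show thesis by (rule that)
qed

text \<open>The centraliser of \<open>c\<close> is cyclic by the criterion \<open>cyclic_of_torsion\<close>, and its index is at most \<open>2\<close> because
  the group acts on \<open>\<langle>c\<rangle>\<close>, which is cyclic of order \<open>4\<close>, through \<open>\<plusminus>1\<close>.\<close>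

lemma two_group_cyclic_or_maximal_class:
  assumes G: "order G = 2 ^ n" and c: "c \<in> carrier G" "ord c = 4"
    and norm: "\<And>g. g \<in> carrier G \<Longrightarrow> g \<otimes> c \<otimes> inv g \<in> generate G {c}"
    and tors: "\<And>y. y \<in> carrier G \<Longrightarrow> y [^] (2::nat) = \<one> \<Longrightarrow> y \<otimes> c = c \<otimes> y \<Longrightarrow> y \<in> generate G {c}"
  shows "cyclic_group G \<or> maximal_class_2_group G"
proof -
  define C where "C = {y \<in> carrier G. y \<otimes> c = c \<otimes> y}"
  have Csub: "subgroup C G"
  proof (rule subgroupI)
    show "C \<subseteq> carrier G" "C \<noteq> {}" unfolding C_def using c by auto
    show "inv a \<in> C" if "a \<in> C" for a
    proof -
      have a: "a \<in> carrier G" "a \<otimes> c = c \<otimes> a" using that C_def by auto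
      have "inv a \<otimes> (a \<otimes> c) \<otimes> inv a = inv a \<otimes> (c \<otimes> a) \<otimes> inv a" using a by simp
      then have "c \<otimes> inv a = inv a \<otimes> c" using a(1) c(1) by (simp add: m_assoc cancel_inv_left)
      then show ?thesis unfolding C_def using a by simp
    qed
    show "a \<otimes> b \<in> C" if "a \<in> C" "b \<in> C" for a b
    proof -
      have ab: "a \<in> carrier G" "a \<otimes> c = c \<otimes> a" "b \<in> carrier G" "b \<otimes> c = c \<otimes> b" using that C_def by auto
      have "a \<otimes> b \<otimes> c = a \<otimes> (c \<otimes> b)" using ab c by (simp add: m_assoc)
      also have "\<dots> = c \<otimes> a \<otimes> b" using ab c by (simp flip: m_assoc)
      also have "\<dots> = c \<otimes> (a \<otimes> b)" using ab c by (simp add: m_assoc)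
      finally show ?thesis unfolding C_def using ab by simp
    qed
  qed
  have "card C dvd 2 ^ n" using lagrange[OF Csub] G by (metis dvd_triv_right)
  then obtain m where m: "card C = 2 ^ m" using divides_primepow_nat[OF two_is_prime_nat] by blast
  have "c \<noteq> \<one>" using c by (metis ord_eq_1 one_eq_numeral_iff semiring_norm(83) numeral_One)
  have cC: "c \<in> C" using c C_def by simp
  obtain d where d: "d \<in> C" "generate G {d} = C"
  proof (rule cyclic_of_torsion[OF two_is_prime_nat Csub m cC \<open>c \<noteq> \<one>\<close>])
    show "y \<in> generate G {c}" if "y \<in> C" "y [^] (2::nat) = \<one>" for y
      using that tors unfolding C_def by simp
    show "y \<otimes> c = c \<otimes> y" if "y \<in> C" for y using that unfolding C_def by simp
  qed (use c in simp)
  have dG: "d \<in> carrier G" using d C_def by simp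
  have dich: "g \<otimes> c = c [^] (3::nat) \<otimes> g" if g: "g \<in> carrier G" "g \<notin> C" for g
  proof -
    obtain r :: nat where r: "g \<otimes> c = c [^] r \<otimes> g" using conj_eq_pow[OF g(1) c(1) norm[OF g(1)]] .
    have "odd r"
    proof
      assume "even r"
      then have "ord c dvd 2 * r" unfolding c(2) by presburger
      then have "c [^] (2 * r) = \<one>" using pow_eq_id[OF c(1)] by simp
      then have "g \<otimes> c [^] (2::nat) = g" using conj_pow[OF g(1) c(1) r, of 2] g by simp
      then have "c [^] (2::nat) = \<one>" using g c by simp
      then show False using pow_eq_id[OF c(1)] c(2) by simp
    qed
    moreover have "r mod 4 \<noteq> 1"
    proof
      assume "r mod 4 = 1"
      then have "[r = 1] (mod ord c)" unfolding c(2) cong_def by simp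
      then have "c [^] r = c [^] (1::nat)" using pow_cong[OF c(1)] by blast
      then show False using r g c unfolding C_def by simp
    qed
    ultimately have "r mod 4 = 3" by presburger
    then have "[r = 3] (mod ord c)" unfolding c(2) cong_def by simp
    then have "c [^] r = c [^] (3::nat)" using pow_cong[OF c(1)] by blast
    then show ?thesis using r by simp
  qed
  show ?thesis
  proof (cases "C = carrier G")
    case True
    then show ?thesis using cyclic_groupI[OF dG] d by simp
  next
    case False
    then obtain x where x: "x \<in> carrier G" "x \<notin> C" unfolding C_def by blast
    have quot: "inv x \<otimes> y \<in> C" if y: "y \<in> carrier G" "y \<notin> C" for y
    proof -
      have "x \<otimes> (inv x \<otimes> y \<otimes> c) = c [^] (3::nat) \<otimes> y" using dich[OF y] x y c by (simp flip: m_assoc)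
      also have "\<dots> = c [^] (3::nat) \<otimes> x \<otimes> (inv x \<otimes> y)" using x y c by (simp add: m_assoc cancel_inv_left)
      also have "\<dots> = x \<otimes> (c \<otimes> (inv x \<otimes> y))" using x y c by (simp add: m_assoc flip: dich[OF x])
      finally have "inv x \<otimes> y \<otimes> c = c \<otimes> (inv x \<otimes> y)" using x y c by simp
      then show ?thesis unfolding C_def using x y by simp
    qed
    have "x \<otimes> d \<otimes> inv x \<in> C"
    proof (rule ccontr)
      assume "x \<otimes> d \<otimes> inv x \<notin> C"
      then have "inv x \<otimes> (x \<otimes> d \<otimes> inv x) \<in> C" using quot x dG by simp
      then have "d \<otimes> inv x \<in> C" using x dG by (simp add: m_assoc cancel_inv_left)
      then have "inv d \<otimes> (d \<otimes> inv x) \<in> C" using d subgroup.m_closed[OF Csub] subgroup.m_inv_closed[OF Csub] by blast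
      then have "inv x \<in> C" using x dG by (simp flip: m_assoc)
      then show False using x subgroup.m_inv_closed[OF Csub] by fastforce
    qed
    then obtain s :: nat where s: "x \<otimes> d = d [^] s \<otimes> x" using conj_eq_pow[OF x(1) dG] d by metis
    \<comment> \<open>Since c is a power of d, the exponent s can be read off modulo 4 from the
      action of x on c: x turns c into c^3 and also into c^s.\<close>
    have "c \<in> generate G {d}" unfolding d(2) C_def using c by simp
    then obtain q :: nat where q: "c = d [^] q" using in_generate_iff[OF dG] by blast
    have "c [^] (3::nat) \<otimes> x = d [^] (q * s) \<otimes> x" using dich[OF x] conj_pow[OF x(1) dG s, of q] q by simp
    also have "d [^] (q * s) = c [^] s" unfolding q using dG by (simp add: nat_pow_pow)
    finally have "c [^] s = c [^] (3::nat)" using x c by simp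
    then have s3: "[s = 3] (mod 4)" by (simp only: pow_cong[OF c(1)] c(2))
    have od: "ord d = 2 ^ m" using card_generate[OF dG] d m by simp
    have "(2::nat) ^ 2 dvd 2 ^ m" using ord_dvd_subgroup[OF Csub, of c] c m C_def by simp
    then have "2 \<le> m" by (rule power_dvd_imp_le) simp
    have "maximal_class_2_group G"
    proof (rule maximal_class_of_index_2[OF dG x(1) _ _ s s3 od \<open>2 \<le> m\<close>])
      show "x \<notin> generate G {d}" using x d by simp
      show "\<exists>h\<in>generate G {d}. g = x \<otimes> h" if "g \<in> carrier G" "g \<notin> generate G {d}" for g
        using quot[of g] that d x by (intro bexI[of _ "inv x \<otimes> g"]) (simp_all flip: m_assoc)
    qed
    then show ?thesis ..
  qed
qed

text \<open>(d x)^p = d^(p w) with w prime to p, so its order is p^(k-1); the order of d x is p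
  times that. If <d> contains all elements of the order of d, then d x lies in <d>, hence so does x:
  this is how uniqueness confines the p-torsion.\<close>

lemma ord_mult_of_torsion:
  assumes p: "Factorial_Ring.prime p" and x: "x \<in> carrier G" and d: "d \<in> carrier G"
    and r: "x \<otimes> d = d [^] (r::nat) \<otimes> x" and r1: "[r = 1] (mod p)" and two: "p = 2 \<Longrightarrow> [r = 1] (mod 4)"
    and xp: "x [^] p = \<one>" and od: "ord d = p ^ k" "2 \<le> k" and odx: "ord (d \<otimes> x) = p ^ l"
  shows "ord (d \<otimes> x) = ord d"
proof -
  obtain w where w: "(\<Sum>t<p. r ^ t) = p * w" "coprime w p"
    using sum_powers_eq_prime_times_unit[OF p r1 two] by blast
  obtain q where q: "k = Suc (Suc q)" using od(2) by (metis add_2_eq_Suc le_Suc_ex)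
  have p0: "0 < p" using prime_gt_0_nat[OF p] .
  have dx: "d \<otimes> x \<in> carrier G" using d x by simp
  have "(d \<otimes> x) [^] p = d [^] (p * w)"
    using mult_pow_of_conj[OF x d r, of 1 p] d w(1) xp by simp
  moreover have "gcd (ord d) (p * w) = p"
  proof -
    have "coprime (p ^ Suc q) w" using w(2) by (simp add: coprime_commute)
    then have "gcd (p * p ^ Suc q) (p * w) = p"
      by (metis coprime_imp_gcd_eq_1 gcd_mult_distrib_nat mult.right_neutral)
    then show ?thesis unfolding od q by simp
  qed
  moreover have "p * w \<noteq> 0"
  proof
    assume "p * w = 0"
    then have "p = 1" using w(2) p0 by simp
    then show False using p by simp
  qed
  ultimately have o1: "ord ((d \<otimes> x) [^] p) = p ^ Suc q"
    using ord_pow_gen[OF d, of "p * w"] od q p0 by simp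
  have "l \<noteq> 0"
  proof
    assume "l = 0"
    then have "d \<otimes> x = \<one>" using odx ord_eq_1[OF dx] by simp
    then have "p ^ Suc q = 1" using o1 by simp
    then show False using prime_gt_1_nat[OF p] by simp
  qed
  then obtain j where j: "l = Suc j" using not0_implies_Suc by blast
  have "ord ((d \<otimes> x) [^] p) = p ^ j" using ord_pow[OF dx, of p] odx j p0 by simp
  then have "j = Suc q" using o1 power_inject_exp[OF prime_gt_1_nat[OF p]] by metis
  then show ?thesis using odx od j q by simp
qed

text \<open>The element of order \<open>4\<close> to which \<open>two_group_cyclic_or_maximal_class\<close> applies is
  \<open>z = c^(ord c / 4)\<close>: for an involution \<open>y\<close> commuting with \<open>z\<close>, the element \<open>c y\<close> has the same order
  as \<open>c\<close>, whence \<open>y \<in> \<langle>c\<rangle>\<close>.\<close>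

lemma two_group_unique_cyclic_subgroup:
  assumes G: "order G = 2 ^ n" and c: "c \<in> carrier G" "4 dvd ord c"
    and uniq: "\<And>y. y \<in> carrier G \<Longrightarrow> ord y = ord c \<Longrightarrow> y \<in> generate G {c}"
  shows "cyclic_group G \<or> maximal_class_2_group G"
proof -
  define q where "q = ord c div 4"
  have q: "ord c = 4 * q" "q \<noteq> 0" using c ord_pos[OF c(1)] unfolding q_def by auto
  define z where "z = c [^] q"
  have zG: "z \<in> carrier G" and zc: "z \<in> generate G {c}" unfolding z_def using c pow_in_generate by auto
  have oz: "ord z = 4" unfolding z_def using ord_pow[OF c(1), of q] q by simp
  have norm_c: "g \<otimes> c \<otimes> inv g \<in> generate G {c}" if "g \<in> carrier G" for g
    using uniq ord_conj[OF that c(1)] that c(1) by simp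
  have conj_z: "g \<otimes> z = z [^] r \<otimes> g" if g: "g \<in> carrier G" and r: "g \<otimes> c = c [^] r \<otimes> g" for g and r :: nat
    using conj_pow[OF g c(1) r, of q] c unfolding z_def by (simp add: nat_pow_pow)
  show ?thesis
  proof (rule two_group_cyclic_or_maximal_class[OF G zG oz])
    fix g assume g: "g \<in> carrier G"
    obtain r :: nat where "g \<otimes> c = c [^] r \<otimes> g" using conj_eq_pow[OF g c(1) norm_c[OF g]] .
    from conj_z[OF g this] have "g \<otimes> z \<otimes> inv g = z [^] r" using g zG by (simp add: m_assoc)
    then show "g \<otimes> z \<otimes> inv g \<in> generate G {z}" using pow_in_generate[OF zG] by simp
  next
    fix y assume y: "y \<in> carrier G" "y [^] (2::nat) = \<one>" "y \<otimes> z = z \<otimes> y"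
    obtain r :: nat where r: "y \<otimes> c = c [^] r \<otimes> y" using conj_eq_pow[OF y(1) c(1) norm_c[OF y(1)]] .
    \<comment> \<open>y acts on <c> by the exponent r and fixes z, whose order is 4; so r = 1 modulo
      4, as \<open>ord_mult_of_torsion\<close> demands.\<close>
    have "z [^] r \<otimes> y = z \<otimes> y" using conj_z[OF y(1) r] y(3) by simp
    then have "z [^] r = z [^] (1::nat)" using y zG by simp
    then have "[r = 1] (mod 4)" by (simp only: pow_cong[OF zG] oz)
    note r4 = this
    define t where "t = c \<otimes> y"
    have tG: "t \<in> carrier G" unfolding t_def using c y by simp
    obtain k where k: "ord c = 2 ^ k"
      using ord_dvd_group_order[OF c(1)] G divides_primepow_nat[OF two_is_prime_nat] by auto
    have "(2::nat) ^ 2 dvd 2 ^ k" using c(2) k by simp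
    then have "2 \<le> k" by (rule power_dvd_imp_le) simp
    obtain l where l: "ord t = 2 ^ l"
      using ord_dvd_group_order[OF tG] G divides_primepow_nat[OF two_is_prime_nat] by auto
    have "[r = 1] (mod 2)" using r4 by (rule cong_dvd_modulus_nat) simp
    then have "ord t = ord c"
      unfolding t_def using ord_mult_of_torsion[OF two_is_prime_nat y(1) c(1) r _ r4 y(2) k \<open>2 \<le> k\<close>] l t_def by simp
    then have "t \<in> generate G {c}" using uniq tG by simp
    then have "inv c \<otimes> t \<in> generate G {c}"
      using generate_is_subgroup[of "{c}"] generate_self[OF c(1)] c(1) subgroup.m_closed subgroup.m_inv_closed
      by (metis empty_subsetI insert_subset)
    then have yc: "y \<in> generate G {c}" unfolding t_def using c y by (simp flip: m_assoc)
    have "ord y dvd 2" using pow_eq_id[OF y(1)] y(2) by simp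
    then have "ord y dvd ord z" unfolding oz by (rule dvd_trans) simp
    then show "y \<in> generate G {z}" using generate_of_ord_dvd[OF c(1) zc yc] by simp
  qed
qed

text \<open>Conjugation permutes the cosets of \<open>Z = {1, z}\<close>, an even number of them, and fixes \<open>Z\<close>; hence it
  fixes another coset \<open>Z x\<close>, and a power of \<open>x\<close> generates a normal subgroup of order \<open>4\<close>.\<close>

lemma two_group_unique_involution:
  assumes G: "order G = 2 ^ n" and z: "z \<in> carrier G" "z \<noteq> \<one>" "z [^] (2::nat) = \<one>"
    and uniq: "\<And>y. y \<in> carrier G \<Longrightarrow> y [^] (2::nat) = \<one> \<Longrightarrow> y = \<one> \<or> y = z"
  shows "cyclic_group G \<or> maximal_class_2_group G"
proof -
  define Z where "Z = generate G {z}"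
  have Zsub: "subgroup Z G" unfolding Z_def by (rule generate_is_subgroup) (use z in simp)
  note ZG = subgroup.subset[OF Zsub]
  have Z_sq: "y [^] (2::nat) = \<one>" if "y \<in> Z" for y
  proof -
    obtain k :: nat where "y = z [^] k" using \<open>y \<in> Z\<close> in_generate_iff[OF z(1)] unfolding Z_def by blast
    then show ?thesis using z by (metis mult.commute nat_pow_one nat_pow_pow)
  qed
  have Z_eq: "Z = {\<one>, z}"
  proof
    show "Z \<subseteq> {\<one>, z}" using Z_sq uniq ZG by blast
    show "{\<one>, z} \<subseteq> Z" using subgroup.one_closed[OF Zsub] generate_self[OF z(1)] unfolding Z_def by simp
  qed
  have cZ: "card Z = 2" unfolding Z_eq using z(2) by simp
  show ?thesis
  proof (cases "Z = carrier G")
    case True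
    then show ?thesis using cyclic_groupI[OF z(1)] unfolding Z_def by simp
  next
    case False
    have zc: "g \<otimes> z = z \<otimes> g" if g: "g \<in> carrier G" for g
    proof -
      have "(g \<otimes> z \<otimes> inv g) [^] (2::nat) = \<one>" using conj_nat_pow[OF g z(1)] z(3) g by simp
      moreover have "g \<otimes> z \<otimes> inv g \<noteq> \<one>"
      proof
        assume "g \<otimes> z \<otimes> inv g = \<one>"
        then have "ord z = 1" using ord_conj[OF g z(1)] by simp
        then show False using z ord_eq_1 by blast
      qed
      ultimately have "g \<otimes> z \<otimes> inv g = z" using uniq[of "g \<otimes> z \<otimes> inv g"] g z(1) by fastforce
      then show ?thesis using g z(1) by (metis inv_solve_right m_closed)
    qed
    have coset: "Z #> x = {x, z \<otimes> x}" if "x \<in> carrier G" for x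
      unfolding Z_eq r_coset_def using that by auto
    define act where "act g A = (\<lambda>a. g \<otimes> a \<otimes> inv g) ` A" for g A
    have act_coset: "act g (Z #> x) = Z #> (g \<otimes> x \<otimes> inv g)" if g: "g \<in> carrier G" and x: "x \<in> carrier G" for g x
    proof -
      have "g \<otimes> (z \<otimes> x) \<otimes> inv g = (g \<otimes> z) \<otimes> x \<otimes> inv g" using g x z(1) by (simp add: m_assoc)
      also have "\<dots> = z \<otimes> (g \<otimes> x \<otimes> inv g)" unfolding zc[OF g] using g x z(1) by (simp add: m_assoc)
      finally show ?thesis unfolding act_def using coset[OF x] coset[of "g \<otimes> x \<otimes> inv g"] g x by simp
    qed
    define E where "E = (\<lambda>g. Z #> g) ` carrier G"
    have cE: "card E * 2 = 2 ^ n"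
      using card_cosets_mult[OF Zsub subgroup_self ZG] cZ G unfolding E_def order_def by simp
    have "card E \<noteq> 1"
    proof
      assume "card E = 1"
      then have "card (carrier G) = card Z" using cE G cZ by (simp add: order_def)
      then show False using False card_subset_eq[OF finite_carrier ZG] by simp
    qed
    moreover have "\<exists>i. card E = 2 ^ i" using cE divides_primepow_nat[OF two_is_prime_nat, of "card E" n] by (metis dvd_triv_left)
    ultimately have E_even: "2 dvd card E" by (metis dvd_power gr0I power_0)
    define F where "F = {C \<in> E. \<forall>g\<in>carrier G. act g C = C}"
    have "[card F = card E] (mod 2)" unfolding F_def
    proof (rule p_group_fixed_points[OF two_is_prime_nat subgroup_self])
      show "card (carrier G) = 2 ^ n" using G by (simp add: order_def)
      show "finite E" unfolding E_def using finite_carrier by simp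
      show "act g C \<in> E" if "g \<in> carrier G" "C \<in> E" for g C
        using that act_coset unfolding E_def by auto
      show "act \<one> C = C" if "C \<in> E" for C
        using that act_coset[of \<one>] unfolding E_def by auto
      show "act (g \<otimes> g') C = act g (act g' C)" if "g \<in> carrier G" "g' \<in> carrier G" "C \<in> E" for g g' C
        using that act_coset unfolding E_def by (auto simp: inv_mult_group m_assoc)
    qed
    then have F_even: "2 dvd card F" using E_even by (simp add: cong_dvd_iff)
    have ZF: "Z #> \<one> \<in> F"
    proof -
      have "Z #> \<one> \<in> E" unfolding E_def by blast
      moreover have "act g (Z #> \<one>) = Z #> \<one>" if "g \<in> carrier G" for g using act_coset[OF that] that by simp
      ultimately show ?thesis unfolding F_def by blast
    qed
    have "F \<noteq> {Z #> \<one>}" using F_even by auto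
    then obtain C where C: "C \<in> F" "C \<noteq> Z #> \<one>" using ZF by blast
    then obtain x where x: "x \<in> carrier G" "C = Z #> x" unfolding F_def E_def by auto
    have xZ: "x \<notin> Z"
    proof
      assume "x \<in> Z"
      then have "Z #> x = Z" using coset_join2[OF x(1) Zsub] by simp
      then show False using C(2) x(2) coset_mult_one[OF ZG] by simp
    qed
    have conj_x: "g \<otimes> x \<otimes> inv g = x \<or> g \<otimes> x \<otimes> inv g = z \<otimes> x" if g: "g \<in> carrier G" for g
    proof -
      have "Z #> (g \<otimes> x \<otimes> inv g) = Z #> x" using C(1) x act_coset[OF g x(1)] g unfolding F_def by auto
      then have "g \<otimes> x \<otimes> inv g \<in> Z #> x" using rcos_self[OF _ Zsub, of "g \<otimes> x \<otimes> inv g"] g x by simp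
      then show ?thesis using coset[OF x(1)] by simp
    qed
    have conj_pow_x: "g \<otimes> x [^] k \<otimes> inv g = x [^] k \<or> g \<otimes> x [^] k \<otimes> inv g = z \<otimes> x [^] k" if g: "g \<in> carrier G" for g and k :: nat
    proof -
      have zk: "z [^] k = \<one> \<or> z [^] k = z"
      proof -
        have "z [^] k \<in> Z" unfolding Z_def by (rule pow_in_generate[OF z(1)])
        then show ?thesis using Z_eq by simp
      qed
      have "(z \<otimes> x) [^] k = z [^] k \<otimes> x [^] k" using pow_mult_distrib[of z x k] zc[OF x(1)] x z(1) by simp
      then show ?thesis using conj_x[OF g] conj_nat_pow[OF g x(1), of k] zk x(1) by auto
    qed
    obtain f where "ord x = 2 ^ f"
      using ord_dvd_group_order[OF x(1)] G divides_primepow_nat[OF two_is_prime_nat] by auto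
    then have "x [^] (2 ^ f :: nat) = \<one>" using x(1) pow_ord_eq_1 by metis
    then have "x [^] (2 ^ f :: nat) \<in> Z" using subgroup.one_closed[OF Zsub] by simp
    then have "\<exists>t. x [^] (2 ^ t :: nat) \<in> Z" ..
    \<comment> \<open>c will be the last of the powers x^(2^s) outside Z. Its square lies in Z and
      is not 1, since the only involution is in Z; so the square is z and c has order 4.\<close>
    define t where "t = (LEAST t. x [^] (2 ^ t :: nat) \<in> Z)"
    have t: "x [^] (2 ^ t :: nat) \<in> Z" unfolding t_def by (rule LeastI_ex) fact
    have "t \<noteq> 0" using t xZ x(1) by (metis nat_pow_eone power_0)
    then obtain s where s: "t = Suc s" using not0_implies_Suc by blast
    define c where "c = x [^] (2 ^ s :: nat)"
    have cG: "c \<in> carrier G" unfolding c_def using x by simp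
    have cZ: "c \<notin> Z" using not_less_Least[of s "\<lambda>t. x [^] (2 ^ t :: nat) \<in> Z"] s unfolding c_def t_def by simp
    have "c [^] (2::nat) \<in> Z" using t s x(1) unfolding c_def by (simp add: nat_pow_pow mult.commute)
    moreover have "c [^] (2::nat) \<noteq> \<one>" using uniq[OF cG] cZ Z_eq by auto
    ultimately have c2: "c [^] (2::nat) = z" using Z_eq by simp
    then have c4: "c [^] (4::nat) = \<one>" using z(3) cG nat_pow_pow[OF cG, of 2 2] by simp
    have "ord c dvd 2 ^ 2" using c4 pow_eq_id[OF cG] by simp
    then obtain i where i: "i \<le> 2" "ord c = 2 ^ i" using divides_primepow_nat[OF two_is_prime_nat] by blast
    have "\<not> ord c dvd 2" using c2 z(2) pow_eq_id[OF cG, of 2] by simp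
    then have "i \<noteq> 0 \<and> i \<noteq> 1" using i(2) by (intro conjI notI) simp_all
    then have "i = 2" using i by simp
    then have oc: "ord c = 4" using i by simp
    have z_c: "z \<in> generate G {c}" using c2 pow_in_generate[OF cG] by metis
    show ?thesis
    proof (rule two_group_cyclic_or_maximal_class[OF G cG oc])
      \<comment> \<open>A conjugate of c is c or z c, and z c = c^3 because z = c^2.\<close>
      show "g \<otimes> c \<otimes> inv g \<in> generate G {c}" if g: "g \<in> carrier G" for g
      proof -
        have "z \<otimes> c = c [^] (3::nat)" using c2 cG by (simp add: numeral_3_eq_3 numeral_2_eq_2)
        then show ?thesis
          using conj_pow_x[OF g, of "2 ^ s"] generate_self[OF cG] pow_in_generate[OF cG, of 3] unfolding c_def by metis
      qed
      show "y \<in> generate G {c}" if "y \<in> carrier G" "y [^] (2::nat) = \<one>" for y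
        using uniq[OF that] z_c generate.one by auto
    qed
  qed
qed

text \<open>It is enough to put every y with y^p = 1 into <u>. If u has order p, this is uniqueness
  itself. Otherwise <u> is normalised by y, and u y has the order of u, so both u y and y lie in
  <u>. For odd p no condition modulo 4 interferes, hence no exceptional families.\<close>

lemma odd_p_group_unique_cyclic_subgroup:
  assumes p: "Factorial_Ring.prime p" "odd p" and S: "subgroup S G" "card S = p ^ n"
    and u: "u \<in> S" "u \<noteq> \<one>" and uniq: "\<And>y. y \<in> S \<Longrightarrow> ord y = ord u \<Longrightarrow> y \<in> generate G {u}"
  obtains d where "d \<in> S" "generate G {d} = S"
proof -
  note SG = subgroup.mem_carrier[OF S(1)]
  have uG: "u \<in> carrier G" using u SG by simp
  have ppow: "\<exists>e. ord y = p ^ e" if "y \<in> S" for y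
    using ord_dvd_subgroup[OF S(1) that] S(2) divides_primepow_nat[OF p(1)] by auto
  obtain k where k: "ord u = p ^ k" using ppow u by blast
  have "k \<noteq> 0" using k u(2) ord_eq_1[OF uG] by auto
  have p2: "p \<noteq> 2" using p(2) by auto
  have tors: "y \<in> generate G {u}" if y: "y \<in> S" "y [^] p = \<one>" for y
  proof (cases "k = 1")
    case True
    have yG: "y \<in> carrier G" using y SG by simp
    have "ord y dvd p" using y pow_eq_id[OF yG] by simp
    then have "ord y = 1 \<or> ord y = p" using p(1) prime_nat_iff by blast
    then show ?thesis
    proof
      assume "ord y = 1"
      then have "y = \<one>" using ord_eq_1[OF yG] by simp
      then show ?thesis by (simp add: generate.one)
    next
      assume "ord y = p"
      then show ?thesis using uniq y k True by simp
    qed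
  next
    case False
    then have k2: "2 \<le> k" using \<open>k \<noteq> 0\<close> by simp
    have yG: "y \<in> carrier G" using y SG by simp
    have "y \<otimes> u \<otimes> inv y \<in> S" using y u subgroup.m_closed[OF S(1)] subgroup.m_inv_closed[OF S(1)] by blast
    then have "y \<otimes> u \<otimes> inv y \<in> generate G {u}" using uniq ord_conj[OF yG uG] by simp
    then obtain r :: nat where r: "y \<otimes> u = u [^] r \<otimes> y" using conj_eq_pow[OF yG uG] by blast
    have "u = u [^] (r ^ p)" using pow_conj_pow[OF yG uG r, of p] y(2) uG by simp
    then have "u [^] (r ^ p) = u [^] (1::nat)" using uG by simp
    then have "[r ^ p = 1] (mod ord u)" by (simp only: pow_cong[OF uG])
    moreover have "p dvd ord u" using k \<open>k \<noteq> 0\<close> by (simp add: dvd_power)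
    ultimately have "[r ^ p = 1] (mod p)" by (rule cong_dvd_modulus_nat)
    then have r1: "[r = 1] (mod p)" by (rule cong_1_of_pow_prime_cong_1[OF p(1)])
    have uy: "u \<otimes> y \<in> S" using u y subgroup.m_closed[OF S(1)] by blast
    obtain l where l: "ord (u \<otimes> y) = p ^ l" using ppow[OF uy] by blast
    have "ord (u \<otimes> y) = ord u"
      by (rule ord_mult_of_torsion[OF p(1) yG uG r r1 _ y(2) k k2 l]) (use p2 in simp)
    then have "u \<otimes> y \<in> generate G {u}" using uniq[OF uy] by simp
    moreover have "subgroup (generate G {u}) G" by (rule generate_is_subgroup) (use uG in simp)
    ultimately have "inv u \<otimes> (u \<otimes> y) \<in> generate G {u}"
      using generate_self[OF uG] subgroup.m_closed subgroup.m_inv_closed by metis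
    then show ?thesis using cancel_inv_left(1)[OF uG yG] by simp
  qed
  show thesis
    by (rule cyclic_of_torsion[OF p(1) S u tors]) (use p2 that in auto)
qed

lemma ord_mult_coprime:
  assumes x: "x \<in> carrier G" and y: "y \<in> carrier G" and xy: "x \<otimes> y = y \<otimes> x" and cop: "coprime (ord x) (ord y)"
  shows "ord (x \<otimes> y) = ord x * ord y"
proof (rule dvd_antisym)
  show "ord (x \<otimes> y) dvd ord x * ord y" by (rule ord_mul_divides[OF xy x y])
  define n where "n = ord (x \<otimes> y)"
  have "ord a dvd n"
    if a: "a \<in> carrier G" and b: "b \<in> carrier G" and ab: "a \<otimes> b = b \<otimes> a" and c: "coprime (ord a) (ord b)" and n: "n = ord (a \<otimes> b)" for a b
  proof -
    have "(a \<otimes> b) [^] (n * ord b) = \<one>" using a b n pow_eq_id[of "a \<otimes> b" "n * ord b"] by simp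
    moreover have "b [^] (n * ord b) = \<one>" using b pow_eq_id by simp
    ultimately have "a [^] (n * ord b) = \<one>" using pow_mult_distrib[OF ab a b] a by simp
    then show ?thesis using pow_eq_id[OF a] c coprime_dvd_mult_left_iff by blast
  qed
  from this[OF x y xy cop] this[OF y x xy[symmetric]] show "ord x * ord y dvd ord (x \<otimes> y)"
    using cop xy unfolding n_def by (simp add: coprime_commute divides_mult)
qed

end

section \<open>Nilpotent groups\<close>

text \<open>As the commutator w commutes with x and y, x^k y = w^k y x^k, so x^m = 1 gives w^m = 1;
  in the same way w^n = 1.\<close>

lemma (in group) commutator_trivial_of_coprime:
  assumes x: "x \<in> carrier G" and y: "y \<in> carrier G" and w: "w \<in> carrier G" and xy: "x \<otimes> y = w \<otimes> (y \<otimes> x)"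
    and wx: "w \<otimes> x = x \<otimes> w" and wy: "w \<otimes> y = y \<otimes> w"
    and m: "x [^] (m::nat) = \<one>" and n: "y [^] (n::nat) = \<one>" and cop: "coprime m n"
  shows "w = \<one>"
proof -
  have "x [^] k \<otimes> y = w [^] k \<otimes> (y \<otimes> x [^] k)" for k :: nat
  proof (induction k)
    case (Suc k)
    have "x [^] Suc k \<otimes> y = x [^] k \<otimes> (x \<otimes> y)" using x y by (simp add: m_assoc)
    also have "\<dots> = (x [^] k \<otimes> w) \<otimes> (y \<otimes> x)" unfolding xy using x y w by (simp add: m_assoc)
    also have "x [^] k \<otimes> w = w \<otimes> x [^] k" using group_commutes_pow[OF wx[symmetric] x w] by simp
    also have "w \<otimes> x [^] k \<otimes> (y \<otimes> x) = w \<otimes> (x [^] k \<otimes> y) \<otimes> x" using x y w by (simp add: m_assoc)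
    also have "\<dots> = (w \<otimes> w [^] k) \<otimes> (y \<otimes> (x [^] k \<otimes> x))" unfolding Suc using x y w by (simp add: m_assoc)
    also have "w \<otimes> w [^] k = w [^] Suc k" using w by (metis nat_pow_Suc2)
    finally show ?case by simp
  qed (use x y in simp)
  from this[of m] have "y = w [^] m \<otimes> y" using x y m by simp
  then have wm: "w [^] m = \<one>" using y w by (metis nat_pow_closed one_closed l_one right_cancel)
  have "x \<otimes> y [^] k = w [^] k \<otimes> (y [^] k \<otimes> x)" for k :: nat
  proof (induction k)
    case (Suc k)
    have "x \<otimes> y [^] Suc k = (x \<otimes> y [^] k) \<otimes> y" using x y by (simp add: m_assoc)
    also have "\<dots> = w [^] k \<otimes> y [^] k \<otimes> (x \<otimes> y)" unfolding Suc using x y w by (simp add: m_assoc)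
    also have "\<dots> = w [^] k \<otimes> (y [^] k \<otimes> w) \<otimes> (y \<otimes> x)" unfolding xy using x y w by (simp add: m_assoc)
    also have "y [^] k \<otimes> w = w \<otimes> y [^] k" using group_commutes_pow[OF wy[symmetric] y w] by simp
    also have "w [^] k \<otimes> (w \<otimes> y [^] k) \<otimes> (y \<otimes> x) = (w [^] k \<otimes> w) \<otimes> ((y [^] k \<otimes> y) \<otimes> x)"
      using x y w by (simp add: m_assoc)
    finally show ?case by simp
  qed (use x y in simp)
  from this[of n] have "x = w [^] n \<otimes> x" using x y n by simp
  then have wn: "w [^] n = \<one>" using x w by (metis nat_pow_closed one_closed l_one right_cancel)
  have "ord w dvd m" "ord w dvd n" using wm wn pow_eq_id[OF w] by simp_all
  then have "ord w = 1" using cop coprime_common_divisor_nat by blast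
  then show ?thesis using ord_eq_1[OF w] by simp
qed

lemma (in group) commutator_subgroup_mono:
  assumes "H \<subseteq> H'" "H' \<subseteq> carrier G"
  shows "commutator_subgroup G H (carrier G) \<subseteq> commutator_subgroup G H' (carrier G)"
  unfolding commutator_subgroup_def by (rule mono_generate) (use assms in blast)

lemma (in group) commutator_subgroup_is_subgroup:
  assumes "H \<subseteq> carrier G"
  shows "subgroup (commutator_subgroup G H (carrier G)) G"
  unfolding commutator_subgroup_def by (rule generate_is_subgroup) (use assms in auto)

lemma (in group) commutator_in_commutator_subgroup:
  assumes "h \<in> H" "k \<in> carrier G"
  shows "h \<otimes> k \<otimes> inv h \<otimes> inv k \<in> commutator_subgroup G H (carrier G)"
  unfolding commutator_subgroup_def by (rule generate.incl) (use assms in blast)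

lemma (in group) lower_central_1: "lower_central G (Suc 0) = carrier G"
  unfolding lower_central_def by simp

lemma (in group) lower_central_subgroup: "subgroup (lower_central G (Suc i)) G"
proof (induction i)
  case 0
  show ?case unfolding lower_central_1 by (rule subgroup_self)
next
  case (Suc i)
  show ?case
    using commutator_subgroup_is_subgroup[OF subgroup.subset[OF Suc]] lower_central_Suc[of "Suc i" G] by simp
qed

lemma (in group) lower_central_decreasing: "lower_central G (Suc (Suc i)) \<subseteq> lower_central G (Suc i)"
proof (induction i)
  case 0
  show ?case unfolding lower_central_1 by (rule subgroup.subset[OF lower_central_subgroup])
next
  case (Suc i)
  show ?case
    using commutator_subgroup_mono[OF Suc subgroup.subset[OF lower_central_subgroup]]
      lower_central_Suc[of "Suc i" G] lower_central_Suc[of "Suc (Suc i)" G] by simp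
qed

lemma (in group) commutator_in_lower_central:
  assumes "h \<in> lower_central G (Suc i)" "k \<in> carrier G"
  shows "h \<otimes> k \<otimes> inv h \<otimes> inv k \<in> lower_central G (Suc (Suc i))"
  using commutator_in_commutator_subgroup[OF assms] lower_central_Suc[of "Suc i" G] by simp

text \<open>k h k^-1 = [h, k]^-1 h, and [h, k] lies in the next, smaller term.\<close>

lemma (in group) lower_central_normal: "lower_central G (Suc i) \<lhd> G"
  unfolding normal_inv_iff
proof (intro conjI ballI)
  let ?L = "lower_central G (Suc i)"
  show sub: "subgroup ?L G" by (rule lower_central_subgroup)
  fix k h assume k: "k \<in> carrier G" and h: "h \<in> ?L"
  have hG: "h \<in> carrier G" using subgroup.mem_carrier[OF sub h] .
  have "h \<otimes> k \<otimes> inv h \<otimes> inv k \<in> ?L" using commutator_in_lower_central[OF h k] lower_central_decreasing by blast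
  then have "inv (h \<otimes> k \<otimes> inv h \<otimes> inv k) \<otimes> h \<in> ?L" using subgroup.m_closed[OF sub] subgroup.m_inv_closed[OF sub] h by blast
  moreover have "inv (h \<otimes> k \<otimes> inv h \<otimes> inv k) \<otimes> h = k \<otimes> h \<otimes> inv k" using h k hG by (simp add: inv_mult_group m_assoc)
  ultimately show "k \<otimes> h \<otimes> inv k \<in> ?L" by simp
qed

text \<open>By induction, the commutator \<open>w\<close> of \<open>x\<close> and \<open>y\<close> lies in every term of the lower central series:
  modulo the next term \<open>w\<close> is central, so \<open>w^m\<close> and \<open>w^n\<close> vanish there.\<close>

lemma nilpotent_coprime_commute:
  fixes G (structure)
  assumes nil: "nilpotent_group G" and x: "x \<in> carrier G" and y: "y \<in> carrier G"
    and m: "x [^] (m::nat) = \<one>" and n: "y [^] (n::nat) = \<one>" and cop: "coprime m n"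
  shows "x \<otimes> y = y \<otimes> x"
proof -
  interpret group G using nil unfolding nilpotent_group_def by blast
  define w where "w = x \<otimes> y \<otimes> inv x \<otimes> inv y"
  have wG: "w \<in> carrier G" unfolding w_def using x y by simp
  have xy: "x \<otimes> y = w \<otimes> (y \<otimes> x)" unfolding w_def using x y by (simp add: m_assoc cancel_inv_left)
  have "w \<in> lower_central G (Suc i)" for i
  proof (induction i)
    case 0
    show ?case using wG lower_central_1 by simp
  next
    case (Suc i)
    define N where "N = lower_central G (Suc (Suc i))"
    interpret N: normal N G unfolding N_def by (rule lower_central_normal)
    interpret q: group_hom G "G Mod N" "\<lambda>a. N #> a"
      by (intro group_hom.intro group_hom_axioms.intro is_group N.factorgroup_is_group N.r_coset_hom_Mod)
    have central: "(N #> w) \<otimes>\<^bsub>G Mod N\<^esub> (N #> k) = (N #> k) \<otimes>\<^bsub>G Mod N\<^esub> (N #> w)" if k: "k \<in> carrier G" for k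
    proof -
      define e where "e = w \<otimes> k \<otimes> inv w \<otimes> inv k"
      have eN: "e \<in> N" unfolding e_def N_def by (rule commutator_in_lower_central[OF Suc k])
      have eG: "e \<in> carrier G" and kw: "k \<otimes> w \<in> carrier G" unfolding e_def using wG k by simp_all
      have "w \<otimes> k = e \<otimes> (k \<otimes> w)" unfolding e_def using wG k by (simp add: m_assoc cancel_inv_left)
      then have "N #> (w \<otimes> k) = (N #> e) #> (k \<otimes> w)"
        using coset_mult_assoc[OF N.subset eG kw] by (simp only:)
      also have "N #> e = N" by (rule N.rcos_const[OF is_group eN])
      finally have "N #> (w \<otimes> k) = N #> (k \<otimes> w)" .
      then show ?thesis using q.hom_mult[OF wG k] q.hom_mult[OF k wG] by simp
    qed
    have "N #> w = \<one>\<^bsub>G Mod N\<^esub>"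
    proof (rule q.H.commutator_trivial_of_coprime[OF _ _ _ _ central[OF x] central[OF y] _ _ cop])
      show "(N #> x) \<otimes>\<^bsub>G Mod N\<^esub> (N #> y) = (N #> w) \<otimes>\<^bsub>G Mod N\<^esub> ((N #> y) \<otimes>\<^bsub>G Mod N\<^esub> (N #> x))"
        using x y wG xy by (metis q.hom_mult m_closed)
      show "(N #> x) [^]\<^bsub>G Mod N\<^esub> m = \<one>\<^bsub>G Mod N\<^esub>" using q.hom_nat_pow[OF x, of m] m q.hom_one by simp
      show "(N #> y) [^]\<^bsub>G Mod N\<^esub> n = \<one>\<^bsub>G Mod N\<^esub>" using q.hom_nat_pow[OF y, of n] n q.hom_one by simp
    qed (use x y wG q.hom_closed in auto)
    then have "N #> w = N" by (simp add: FactGroup_def)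
    then show ?case using coset_join1[OF _ wG N.subgroup_axioms] unfolding N_def by simp
  qed
  moreover obtain i where "1 \<le> i" "lower_central G i = {\<one>}" using nil unfolding nilpotent_group_def by blast
  ultimately have "w = \<one>" by (metis One_nat_def Suc_le_D singletonD)
  then show ?thesis using xy x y by simp
qed

context finite_group
begin

text \<open>Only one primary part of g is changed. For a prime p dividing \<open>ord g\<close>,
  non-cyclic Sylow subgroups provide an element y of the order of the p-part that lies outside its
  span; nilpotency makes y commute with the remaining part, so orders multiply.\<close>

lemma nilpotent_another_cyclic_subgroup:
  assumes nil: "nilpotent_group G" and od: "odd (order G)" and syl: "no_cyclic_sylow G"
    and g: "g \<in> carrier G" "g \<noteq> \<one>"
  obtains h where "h \<in> carrier G" "ord h = ord g" "h \<notin> generate G {g}"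
proof -
  have "ord g \<noteq> 1" using g ord_eq_1 by blast
  then obtain p where p: "Factorial_Ring.prime p" "p dvd ord g" using prime_factor_nat by blast
  have pG: "p dvd order G" using p(2) ord_dvd_group_order[OF g(1)] by (rule dvd_trans)
  have podd: "odd p" using pG od by (meson dvd_trans)
  have og: "ord g \<noteq> 0" "order G \<noteq> 0" using ord_pos[OF g(1)] odd_pos[OF od] by simp_all
  obtain k m where km: "ord g = p ^ k * m" "\<not> p dvd m"
    using multiplicity_decompose'[of "ord g" p] og p(1) by (metis not_prime_unit)
  have "k \<noteq> 0" using km p(2) by (cases k) auto
  have m0: "m \<noteq> 0" using km og by auto
  have p0: "p ^ k \<noteq> 0" using p(1) by auto
  \<comment> \<open>u and v span the p-part and the p'-part of <g>. Their product need not be g, so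
    y v is compared with g only through its order and through membership in <g>.\<close>
  define u where "u = g [^] m"
  define v where "v = g [^] (p ^ k)"
  have uv: "u \<in> carrier G" "v \<in> carrier G" unfolding u_def v_def using g by auto
  have ou: "ord u = p ^ k" unfolding u_def using ord_pow[OF g(1), of m] km m0 by simp
  have ov: "ord v = m" unfolding v_def using ord_pow[OF g(1), of "p ^ k"] km p0 by simp
  have cop: "coprime (p ^ k) m" using km(2) p(1) by (simp add: prime_imp_coprime)
  obtain a m' where am: "order G = p ^ a * m'" "\<not> p dvd m'" "a = multiplicity p (order G)"
    using multiplicity_decompose'[of "order G" p] og p(1) multiplicity_decompose[of "order G" p] by (metis not_prime_unit)
  obtain S where S: "subgroup S G" "card S = p ^ a"
    using sylow_thm[OF p(1) is_group am(1) finite_carrier] by blast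
  have "sylow_subgroup G p S" unfolding sylow_subgroup_def using S am(3) by simp
  then have nc: "\<not> cyclic_group (G\<lparr>carrier := S\<rparr>)" using syl p(1) pG unfolding no_cyclic_sylow_def by blast
  have gu: "subgroup (generate G {u}) G" by (rule generate_is_subgroup) (use uv in simp)
  have cu: "card (generate G {u}) = p ^ k" using card_generate[OF uv(1)] ou by simp
  have "order G div card S = m'" using am(1) S(2) prime_gt_0_nat[OF p(1)] by simp
  then have "\<not> p dvd order G div card S" using am(2) by simp
  \<comment> \<open>S is an arbitrary Sylow subgroup, so u is first conjugated into it, and the
    element found there is conjugated back.\<close>
  then obtain t where t: "t \<in> carrier G" "\<And>h. h \<in> generate G {u} \<Longrightarrow> t \<otimes> h \<otimes> inv t \<in> S"
    using p_subgroup_conj_into[OF p(1) gu cu S(1)] by blast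
  define u' where "u' = t \<otimes> u \<otimes> inv t"
  have u'S: "u' \<in> S" unfolding u'_def using t generate_self[OF uv(1)] by blast
  have u'G: "u' \<in> carrier G" unfolding u'_def using t uv by simp
  have ou': "ord u' = p ^ k" unfolding u'_def using ord_conj[OF t(1) uv(1)] ou by simp
  have "u' \<noteq> \<one>"
  proof
    assume "u' = \<one>"
    then have "p ^ k = 1" using ou' by simp
    then show False using \<open>k \<noteq> 0\<close> p(1) by simp
  qed
  have "\<exists>y\<in>S. ord y = ord u' \<and> y \<notin> generate G {u'}"
  proof (rule ccontr)
    assume "\<not> ?thesis"
    then obtain d where d: "d \<in> S" "generate G {d} = S"
      using odd_p_group_unique_cyclic_subgroup[OF p(1) podd S u'S \<open>u' \<noteq> \<one>\<close>] by blast
    interpret S: group "G\<lparr>carrier := S\<rparr>" by (rule subgroup.subgroup_is_group[OF S(1) is_group])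
    interpret S: finite_group "G\<lparr>carrier := S\<rparr>"
      by unfold_locales (simp add: finite_subgroup[OF S(1)])
    have "generate (G\<lparr>carrier := S\<rparr>) {d} = S" using generate_consistent[of "{d}" S] d S(1) by simp
    then show False using S.cyclic_groupI[of d] d nc by simp
  qed
  then obtain y' where y': "y' \<in> S" "ord y' = p ^ k" "y' \<notin> generate G {u'}" using ou' by auto
  have y'G: "y' \<in> carrier G" using subgroup.mem_carrier[OF S(1)] y' by blast
  define y where "y = inv t \<otimes> y' \<otimes> t"
  have yG: "y \<in> carrier G" unfolding y_def using t y'G by simp
  have y'y: "y' = t \<otimes> y \<otimes> inv t" unfolding y_def using t y'G by (simp add: m_assoc cancel_inv_left)
  have oy: "ord y = p ^ k" using ord_conj[OF t(1) yG] y'y y' by simp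
  have yu: "y \<notin> generate G {u}"
  proof
    assume "y \<in> generate G {u}"
    then obtain j :: nat where "y = u [^] j" using in_generate_iff[OF uv(1)] by blast
    then have "y' = u' [^] j" unfolding y'y u'_def using conj_nat_pow[OF t(1) uv(1)] by simp
    then show False using y' pow_in_generate[OF u'G] by blast
  qed
  have yv: "y \<otimes> v = v \<otimes> y"
    by (rule nilpotent_coprime_commute[OF nil yG uv(2) _ _ cop]) (use pow_ord_eq_1 yG uv oy ov in metis)+
  have "ord (y \<otimes> v) = ord g" using ord_mult_coprime[OF yG uv(2) yv] oy ov cop km by simp
  moreover have "y \<otimes> v \<notin> generate G {g}"
  proof
    \<comment> \<open>The m-th power removes v and keeps a generator of <y>. So y lies in <g>, where
      having the order of u puts it into <u>.\<close>
    assume *: "y \<otimes> v \<in> generate G {g}"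
    have "(y \<otimes> v) [^] m = y [^] m" using pow_mult_distrib[OF yv yG uv(2), of m] pow_ord_eq_1[OF uv(2)] ov yG by simp
    then have "y [^] m \<in> generate G {g}"
      using subgroup_pow_closed[OF _ *, of m] generate_is_subgroup[of "{g}"] g by simp
    moreover have "y \<in> generate G {y [^] m}" by (rule coprime_pow_generates[OF yG]) (use cop oy in \<open>simp add: coprime_commute\<close>)
    ultimately have "y \<in> generate G {g}" using generate_mono_elem[OF g(1)] by blast
    moreover have "u \<in> generate G {g}" unfolding u_def by (rule pow_in_generate[OF g(1)])
    ultimately have "y \<in> generate G {u}" using generate_of_ord_dvd[OF g(1)] oy ou by simp
    then show False using yu by simp
  qed
  ultimately show thesis using that[of "y \<otimes> v"] yG uv by simp
qed

end

section \<open>Cyclic orderings\<close>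

definition cyclically :: "('v \<Rightarrow> 'v \<Rightarrow> bool) \<Rightarrow> 'v list \<Rightarrow> bool" where
  "cyclically R xs \<longleftrightarrow> xs \<noteq> [] \<and> successively R xs \<and> R (last xs) (hd xs)"

lemma cyclically_rotate:
  assumes "cyclically R xs" "x \<in> set xs" "distinct xs"
  obtains ys where "cyclically R ys" "set ys = set xs" "distinct ys" "hd ys = x"
proof -
  obtain as bs where xs: "xs = as @ x # bs" using assms(2) by (meson split_list)
  show thesis
  proof (cases "as = []")
    case True
    then show ?thesis using that assms xs by auto
  next
    case False
    show ?thesis
    proof (rule that)
      show "cyclically R ((x # bs) @ as)"
        using assms(1) False unfolding cyclically_def xs successively_append_iff by auto
      show "set ((x # bs) @ as) = set xs" unfolding xs by auto
      show "distinct ((x # bs) @ as)" using assms(3) unfolding xs by auto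
    qed simp
  qed
qed

lemma cyclically_nth:
  assumes "cyclically R xs" "i < length xs"
  shows "R (xs ! i) (xs ! (Suc i mod length xs))"
proof (cases "Suc i < length xs")
  case True
  then show ?thesis using assms unfolding cyclically_def by (simp add: successively_conv_nth)
next
  case False
  then have "Suc i = length xs" using assms(2) by simp
  then have "i = length xs - 1" "Suc i mod length xs = 0" by auto
  then show ?thesis using assms unfolding cyclically_def by (auto simp: last_conv_nth hd_conv_nth)
qed

lemma cyclically_permutation:
  assumes "cyclically R xs" "distinct xs"
  obtains f where "bij_betw f (set xs) (set xs)" "\<And>x. x \<in> set xs \<Longrightarrow> R x (f x)"
proof -
  let ?N = "length xs"
  have N: "0 < ?N" using assms unfolding cyclically_def by simp
  define s where "s i = Suc i mod ?N" for i
  have "inj_on s {..<?N}"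
  proof (rule inj_onI)
    fix i j assume ij: "i \<in> {..<?N}" "j \<in> {..<?N}" "s i = s j"
    then show "i = j" unfolding s_def by (auto simp: mod_Suc split: if_splits)
  qed
  moreover have "s ` {..<?N} \<subseteq> {..<?N}" unfolding s_def using N by auto
  ultimately have s: "bij_betw s {..<?N} {..<?N}"
    by (simp add: bij_betw_def endo_inj_surj)
  have nth: "bij_betw ((!) xs) {..<?N} (set xs)" using assms(2) by (intro bij_betw_nth) auto
  \<comment> \<open>\<open>f\<close> sends an entry to its cyclic successor in the list.\<close>
  define f where "f = (!) xs \<circ> s \<circ> inv_into {..<?N} ((!) xs)"
  have "bij_betw f (set xs) (set xs)" unfolding f_def
    by (rule bij_betw_trans[OF bij_betw_inv_into[OF nth] bij_betw_trans[OF s nth]])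
  moreover have "R x (f x)" if x: "x \<in> set xs" for x
  proof -
    obtain i where i: "i < ?N" "x = xs ! i" using x by (auto simp: in_set_conv_nth)
    then have "inv_into {..<?N} ((!) xs) x = i" using bij_betw_inv_into_left[OF nth, of i] by simp
    then have "f x = xs ! (Suc i mod ?N)" unfolding f_def s_def by simp
    then show ?thesis using cyclically_nth[OF assms(1) i(1)] i(2) by simp
  qed
  ultimately show thesis by (rule that)
qed

text \<open>The r fibres are dealt out in turn: position j holds element j div r of fibre j mod r.
  Neighbouring positions differ modulo r because r \<ge> 2. Equal fibre sizes make the length a
  multiple of r, so the last position is r - 1 modulo r and differs from the first as well.\<close>

lemma cyclic_ordering_of_equal_fibres:
  assumes S: "finite S" "x0 \<in> S" "x1 \<in> S" "K x0 \<noteq> K x1"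
    and fib: "\<And>x. x \<in> S \<Longrightarrow> card {y \<in> S. K y = K x} = m"
  obtains xs where "cyclically (\<lambda>x y. K x \<noteq> K y) xs" "set xs = S" "distinct xs"
proof -
  obtain ks where ks: "set ks = K ` S" "distinct ks" using S(1) finite_distinct_list by (metis finite_imageI)
  define r where "r = length ks"
  have "card {K x0, K x1} \<le> card (K ` S)" by (rule card_mono) (use S in auto)
  then have r2: "2 \<le> r" unfolding r_def using S(4) ks distinct_card by fastforce
  have "\<exists>f. bij_betw f {0..<m} {y \<in> S. K y = \<kappa>}" if "\<kappa> \<in> K ` S" for \<kappa>
  proof -
    have "card {y \<in> S. K y = \<kappa>} = m" using fib that by auto
    moreover have "finite {y \<in> S. K y = \<kappa>}" using S(1) by simp
    ultimately show ?thesis using ex_bij_betw_nat_finite by metis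
  qed
  then obtain f where f: "\<And>\<kappa>. \<kappa> \<in> K ` S \<Longrightarrow> bij_betw (f \<kappa>) {0..<m} {y \<in> S. K y = \<kappa>}" by metis
  define g where "g j = f (ks ! (j mod r)) (j div r)" for j
  have mod_r: "i mod r < length ks" for i
    using mod_less_divisor[of r i] r2 unfolding r_def by linarith
  have ks_in: "ks ! (j mod r) \<in> K ` S" for j using nth_mem[OF mod_r] ks(1) by blast
  have g: "g j \<in> S \<and> K (g j) = ks ! (j mod r)" if "j < r * m" for j
  proof -
    have "j div r \<in> {0..<m}" using that by (simp add: less_mult_imp_div_less mult.commute)
    then show ?thesis unfolding g_def using f[OF ks_in] bij_betwE by fastforce
  qed
  have inj: "inj_on g {..<r * m}"
  proof (rule inj_onI)
    fix i j assume ij: "i \<in> {..<r * m}" "j \<in> {..<r * m}" "g i = g j"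
    then have "ks ! (i mod r) = ks ! (j mod r)" using g by (metis lessThan_iff)
    then have mods: "i mod r = j mod r" using nth_eq_iff_index_eq[OF ks(2) mod_r mod_r] by simp
    have "i div r \<in> {0..<m}" "j div r \<in> {0..<m}" using ij by (auto simp: less_mult_imp_div_less mult.commute)
    moreover have "f (ks ! (i mod r)) (i div r) = f (ks ! (i mod r)) (j div r)" using ij(3) mods unfolding g_def by simp
    ultimately have "i div r = j div r" using f[OF ks_in] unfolding bij_betw_def inj_on_def by blast
    then show "i = j" using mods by (metis div_mult_mod_eq)
  qed
  have surj: "g ` {..<r * m} = S"
  proof
    show "g ` {..<r * m} \<subseteq> S" using g by auto
    show "S \<subseteq> g ` {..<r * m}"
    proof
      fix y assume y: "y \<in> S"
      then obtain a where a: "a < r" "ks ! a = K y" using ks(1) unfolding r_def by (metis imageI in_set_conv_nth)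
      have "y \<in> f (K y) ` {0..<m}" using f[of "K y"] y unfolding bij_betw_def by blast
      then obtain i where i: "i < m" "y = f (K y) i" by auto
      have "i * r + a < r * m"
      proof -
        have "i * r + a < Suc i * r" using a by simp
        also have "\<dots> \<le> m * r" using i by (intro mult_right_mono) auto
        finally show ?thesis by (simp add: mult.commute)
      qed
      moreover have "g (i * r + a) = y" unfolding g_def using a i by simp
      ultimately show "y \<in> g ` {..<r * m}" by blast
    qed
  qed
  have m0: "0 < r * m" using surj S(2) by (metis empty_iff gr0I image_empty lessThan_0)
  define xs where "xs = map g [0..<r * m]"
  have "set xs = S" unfolding xs_def using surj by (simp add: atLeast0LessThan)
  moreover have "distinct xs" unfolding xs_def using inj by (simp add: distinct_map atLeast0LessThan)
  moreover have "cyclically (\<lambda>x y. K x \<noteq> K y) xs" unfolding cyclically_def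
  proof (intro conjI)
    show "xs \<noteq> []" unfolding xs_def using m0 by simp
    have neq: "ks ! (i mod r) \<noteq> ks ! (j mod r)" if "i mod r \<noteq> j mod r" for i j
      using that nth_eq_iff_index_eq[OF ks(2) mod_r mod_r] by simp
    show "successively (\<lambda>x y. K x \<noteq> K y) xs" unfolding successively_conv_nth
    proof (intro allI impI)
      fix i assume "Suc i < length xs"
      then have i: "Suc i < r * m" unfolding xs_def by simp
      have "i mod r \<noteq> Suc i mod r" using r2 by (simp add: mod_Suc)
      then show "K (xs ! i) \<noteq> K (xs ! Suc i)" using i g[of i] g[of "Suc i"] neq unfolding xs_def by simp
    qed
    have l: "last xs = g (r * m - 1)" "hd xs = g 0" unfolding xs_def using m0 by (simp_all add: last_map hd_map)
    have "ks ! ((r * m - 1) mod r) \<noteq> ks ! (0 mod r)"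
    proof (rule neq, rule notI)
      assume "(r * m - 1) mod r = 0 mod r"
      then have "r dvd r * m - 1" by (simp add: dvd_eq_mod_eq_0)
      then have "r dvd 1" using m0 by (metis dvd_diffD1 dvd_triv_left less_eq_Suc_le One_nat_def)
      then show False using r2 by simp
    qed
    then show "K (last xs) \<noteq> K (hd xs)" unfolding l using g[of 0] g[of "r * m - 1"] m0 by simp
  qed
  ultimately show thesis using that by blast
qed

lemma successively_concat:
  assumes "\<And>b. b \<in> set bs \<Longrightarrow> b \<noteq> [] \<and> successively R b"
    and "\<And>b b'. b \<in> set bs \<Longrightarrow> b' \<in> set bs \<Longrightarrow> R (last b) (hd b')"
  shows "successively R (concat bs)"
  using assms
proof (induction bs)
  case (Cons b bs)
  have IH: "successively R (concat bs)" using Cons by simp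
  show ?case
  proof (cases bs)
    case Nil
    then show ?thesis using Cons.prems by simp
  next
    case (Cons b' bs')
    have "b' \<noteq> []" using Cons.prems(1)[of b'] Cons by simp
    then have "hd (concat bs) = hd b'" using Cons by simp
    moreover have "R (last b) (hd b')" using Cons.prems(2)[of b b'] Cons by simp
    ultimately show ?thesis using IH Cons.prems(1)[of b] by (simp add: successively_append_iff)
  qed
qed simp

text \<open>The junction condition is asked for every pair of blocks, including a block with itself,
  so that the order of the blocks is free and the closing junction is covered.\<close>

lemma cyclically_concat:
  assumes "bs \<noteq> []" "\<And>b. b \<in> set bs \<Longrightarrow> b \<noteq> [] \<and> successively R b"
    and "\<And>b b'. b \<in> set bs \<Longrightarrow> b' \<in> set bs \<Longrightarrow> R (last b) (hd b')"
  shows "cyclically R (concat bs)"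
proof -
  have "hd bs \<in> set bs" "last bs \<in> set bs" using assms(1) by simp_all
  moreover have "hd (concat bs) = hd (hd bs)"
    using assms(1,2) by (cases bs) auto
  moreover have "last (concat bs) = last (last bs)"
    using assms(1) assms(2)[of "last bs"] by (cases bs rule: rev_cases) auto
  moreover have "concat bs \<noteq> []" using assms(1,2) by (cases bs) auto
  ultimately show ?thesis unfolding cyclically_def using successively_concat[of bs R] assms by metis
qed

lemma hamiltonian_of_cyclically:
  assumes vs: "cyclically (\<lambda>u v. (u, v) \<in> parcs \<Gamma>) vs" "distinct vs" "3 \<le> length vs" "set vs = pverts \<Gamma>"
  shows "hamiltonian (with_proj \<Gamma>)"
proof -
  obtain v ws where v: "vs = v # ws" using vs(3) by (cases vs) auto
  define p where "p = zip (v # ws) (ws @ [v])"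
  \<comment> \<open>The end vertex u is kept apart from the start v, which changes in the induction;
    both become the same vertex afterwards.\<close>
  have cas: "pcas v (zip (v # ws) (ws @ [u])) u" for u by (induction ws arbitrary: v) auto
  have verts: "pawalk_verts v (zip (v # ws) (ws @ [u])) = v # ws @ [u]" for u by (induction ws arbitrary: v) auto
  have "successively (\<lambda>u v. (u, v) \<in> parcs \<Gamma>) (vs @ [v])"
    unfolding successively_append_iff using vs(1) v unfolding cyclically_def by simp
  then have "successively (\<lambda>u v. (u, v) \<in> parcs \<Gamma>) (v # ws @ [v])" using v by simp
  moreover have "set (zip (v # ws) (ws @ [u])) \<subseteq> E"
    if "successively (\<lambda>u v. (u, v) \<in> E) (v # ws @ [u])" for u E
    using that by (induction ws arbitrary: v) auto
  ultimately have "set (zip (v # ws) (ws @ [v])) \<subseteq> parcs \<Gamma>" by blast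
  then have "pre_digraph.awalk (with_proj \<Gamma>) v p v"
    unfolding pre_digraph.awalk_def p_def cas_with_proj_eq using cas vs(4) v by auto
  then have "pre_digraph.cycle (with_proj \<Gamma>) p"
    unfolding pre_digraph.cycle_def awalk_verts_with_proj_eq using verts[of v] vs(2) v unfolding p_def by (intro exI[of _ v]) auto
  moreover have "fst ` set p = pverts \<Gamma>"
  proof -
    have "map fst p = v # ws" unfolding p_def by (rule map_fst_zip) simp
    then have "fst ` set p = set (v # ws)" by (metis set_map)
    then show ?thesis using v vs(4) by simp
  qed
  moreover have "3 \<le> length p" unfolding p_def using vs(3) v by simp
  ultimately show ?thesis unfolding hamiltonian_def by auto
qed

section \<open>Pairs without a common cyclic subgroup\<close>

context finite_group
begin

text \<open>For elements of the group this is adjacency, see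
  \<open>cyclic_subgroup_generated_pair_iff\<close>. Phrased through a common cyclic overgroup, it
  is lifted easily along homomorphisms and tested by orders alone.\<close>

definition noncyclic_pair :: "'a \<Rightarrow> 'a \<Rightarrow> bool" where
  "noncyclic_pair x y \<longleftrightarrow> \<not> (\<exists>c\<in>carrier G. x \<in> generate G {c} \<and> y \<in> generate G {c})"

lemma noncyclic_pair_commute: "noncyclic_pair x y \<longleftrightarrow> noncyclic_pair y x"
  unfolding noncyclic_pair_def by blast

lemma noncyclic_pairI:
  assumes "ord y dvd ord x" "y \<notin> generate G {x}"
  shows "noncyclic_pair x y"
  unfolding noncyclic_pair_def using assms generate_of_ord_dvd by blast

lemma noncyclic_pair_of_ord_eq:
  assumes "y \<in> carrier G" "ord x = ord y" "generate G {x} \<noteq> generate G {y}"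
  shows "noncyclic_pair x y"
proof -
  have "x \<notin> generate G {y}"
    using assms generate_eq_of_ord_eq[OF assms(1)] by blast
  then show ?thesis using noncyclic_pairI[of x y] assms(2) noncyclic_pair_commute by auto
qed

text \<open>The right-hand side is Euler's totient of \<open>ord x\<close>. What matters is that it
  depends on the order alone: the map z -> <z> has equal fibres on the elements of a given
  order.\<close>

lemma card_generators:
  assumes x: "x \<in> carrier G"
  shows "card {y \<in> carrier G. ord y = ord x \<and> generate G {y} = generate G {x}} = card {i. i < ord x \<and> coprime i (ord x)}"
proof -
  have "{y \<in> carrier G. ord y = ord x \<and> generate G {y} = generate G {x}} = (\<lambda>i. x [^] i) ` {i. i < ord x \<and> coprime i (ord x)}"
  proof (intro Set.set_eqI iffI)
    fix y assume "y \<in> {y \<in> carrier G. ord y = ord x \<and> generate G {y} = generate G {x}}"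
    then have y: "y \<in> carrier G" "ord y = ord x" "y \<in> generate G {x}" using generate_self by auto
    then obtain k :: nat where k: "y = x [^] k" using in_generate_iff[OF x] by blast
    have "coprime k (ord x)" using pow_ord_eq_ord_iff[OF finite_carrier x] y k by simp
    then have "coprime (k mod ord x) (ord x)" by (simp add: coprime_mod_left_iff ord_pos[OF x])
    moreover have "k mod ord x < ord x" using ord_pos[OF x] by simp
    moreover have "y = x [^] (k mod ord x)" unfolding k using pow_cong[OF x] by (simp add: cong_def)
    ultimately show "y \<in> (\<lambda>i. x [^] i) ` {i. i < ord x \<and> coprime i (ord x)}" by blast
  next
    fix y assume "y \<in> (\<lambda>i. x [^] i) ` {i. i < ord x \<and> coprime i (ord x)}"
    then obtain i where i: "y = x [^] i" "coprime i (ord x)" by blast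
    then have "ord y = ord x" using pow_ord_eq_ord_iff[OF finite_carrier x] by simp
    moreover have "y \<in> generate G {x}" unfolding i by (rule pow_in_generate[OF x])
    ultimately show "y \<in> {y \<in> carrier G. ord y = ord x \<and> generate G {y} = generate G {x}}"
      using generate_eq_of_ord_eq[OF x] x i by simp
  qed
  moreover have "inj_on (\<lambda>i. x [^] i) {i. i < ord x \<and> coprime i (ord x)}"
  proof (rule inj_onI)
    fix i j assume ij: "i \<in> {i. i < ord x \<and> coprime i (ord x)}" "j \<in> {i. i < ord x \<and> coprime i (ord x)}" "x [^] i = x [^] j"
    then have "[i = j] (mod ord x)" by (simp only: pow_cong[OF x])
    then show "i = j" using ij by (simp add: cong_def)
  qed
  ultimately show ?thesis by (simp add: card_image)
qed

text \<open>\<open>cyclic_ordering_of_equal_fibres\<close> with key z -> <z>; the element y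
  guarantees a second value of the key.\<close>

lemma cyclic_ordering_of_ord_level:
  assumes "x \<in> carrier G" "y \<in> carrier G" "ord y = ord x" "y \<notin> generate G {x}"
  obtains xs where "cyclically noncyclic_pair xs" "set xs = {z \<in> carrier G. ord z = ord x}" "distinct xs"
proof -
  let ?S = "{z \<in> carrier G. ord z = ord x}"
  have fib: "card {y \<in> ?S. generate G {y} = generate G {z}} = card {i. i < ord x \<and> coprime i (ord x)}" if "z \<in> ?S" for z
  proof -
    have "{y \<in> ?S. generate G {y} = generate G {z}} = {y \<in> carrier G. ord y = ord z \<and> generate G {y} = generate G {z}}"
      using that by auto
    then show ?thesis using card_generators[of z] that by simp
  qed
  have neq: "generate G {x} \<noteq> generate G {y}" using assms(4) generate_self[OF assms(2)] by blast
  obtain xs where xs: "cyclically (\<lambda>x y. generate G {x} \<noteq> generate G {y}) xs" "set xs = ?S" "distinct xs"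
    by (rule cyclic_ordering_of_equal_fibres[of ?S x y "\<lambda>x. generate G {x}", OF _ _ _ neq fib])
      (use assms finite_carrier in auto)
  have R: "noncyclic_pair a b" if "a \<in> set xs" "b \<in> set xs" "generate G {a} \<noteq> generate G {b}" for a b
    using that xs(2) noncyclic_pair_of_ord_eq[of b a] by simp
  have "cyclically noncyclic_pair xs"
    unfolding cyclically_def
  proof (intro conjI)
    show "xs \<noteq> []" using xs(1) unfolding cyclically_def by simp
    then show "noncyclic_pair (last xs) (hd xs)" using R xs(1) unfolding cyclically_def by simp
    show "successively noncyclic_pair xs"
      by (rule successively_mono[of "\<lambda>x y. generate G {x} \<noteq> generate G {y}"]) (use xs(1) R in \<open>auto simp: cyclically_def\<close>)
  qed
  then show thesis using that xs by blast
qed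

text \<open>A single involution is excluded by \<open>two_group_unique_involution\<close>. Two
  distinct ones a and b yield a third: a b if they commute, and the conjugate a b a
  otherwise.\<close>

lemma two_group_three_involutions:
  assumes G: "order G = 2 ^ n" "\<not> cyclic_group G" "\<not> maximal_class_2_group G"
  obtains a b c where "a \<in> carrier G" "b \<in> carrier G" "c \<in> carrier G" "ord a = 2" "ord b = 2" "ord c = 2"
    "a \<noteq> b" "a \<noteq> c" "b \<noteq> c"
proof -
  have inv_iff: "ord y = 2 \<longleftrightarrow> y [^] (2::nat) = \<one> \<and> y \<noteq> \<one>" if y: "y \<in> carrier G" for y
  proof -
    have "y [^] (2::nat) = \<one> \<longleftrightarrow> ord y = 1 \<or> ord y = 2"
      using pow_eq_id[OF y] two_is_prime_nat prime_nat_iff by (metis dvd_refl one_dvd)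
    then show ?thesis using ord_eq_1[OF y] by auto
  qed
  have "\<exists>a\<in>carrier G. ord a = 2"
  proof -
    have "n \<noteq> 0"
    proof
      assume "n = 0"
      then have "carrier G = {\<one>}" using G(1) one_closed unfolding order_def by (metis card_1_singletonE One_nat_def power_0 singletonD)
      then have "cyclic_group G" using cyclic_groupI[of \<one>] generate_one by simp
      then show False using G by simp
    qed
    then have "order G = 2 ^ 1 * 2 ^ (n - 1)" using G(1) by (metis power_add le_add_diff_inverse less_one not_less)
    then obtain H where H: "subgroup H G" "card H = 2 ^ 1"
      using sylow_thm[OF two_is_prime_nat is_group _ finite_carrier] by blast
    then obtain a where a: "a \<in> H" "a \<noteq> \<one>" by (metis card_1_singleton_iff card_le_Suc0_iff_eq finite_subgroup subgroup.one_closed One_nat_def le_refl numeral_2_eq_2 power_one_right Suc_n_not_le_n)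
    then have "a \<in> carrier G" "ord a dvd 2" using H subgroup.mem_carrier[OF H(1)] ord_dvd_subgroup[OF H(1) a(1)] by auto
    then show ?thesis using inv_iff[of a] a(2) pow_eq_id[of a 2] by blast
  qed
  then obtain a where a: "a \<in> carrier G" "ord a = 2" by blast
  have "\<exists>b\<in>carrier G. ord b = 2 \<and> b \<noteq> a"
  proof (rule ccontr)
    assume neg: "\<not> ?thesis"
    have "cyclic_group G \<or> maximal_class_2_group G"
    proof (rule two_group_unique_involution[OF G(1) a(1)])
      show "a \<noteq> \<one>" "a [^] (2::nat) = \<one>" using a inv_iff by auto
      show "y = \<one> \<or> y = a" if "y \<in> carrier G" "y [^] (2::nat) = \<one>" for y
        using neg that inv_iff[OF that(1)] by blast
    qed
    then show False using G by simp
  qed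
  then obtain b where b: "b \<in> carrier G" "ord b = 2" "b \<noteq> a" by blast
  have sq: "a \<otimes> a = \<one>" "b \<otimes> b = \<one>" using a b inv_iff by (auto simp: numeral_2_eq_2)
  have a1: "a \<noteq> \<one>" "b \<noteq> \<one>" using a b by auto
  show thesis
  proof (cases "a \<otimes> b = b \<otimes> a")
    case True
    have "(a \<otimes> b) [^] (2::nat) = \<one>"
      using pow_mult_distrib[OF True a(1) b(1), of 2] a b inv_iff by simp
    moreover have "a \<otimes> b \<noteq> \<one>" using sq a b by (metis l_cancel)
    ultimately have "ord (a \<otimes> b) = 2" using inv_iff a b by simp
    moreover have "a \<noteq> a \<otimes> b" "b \<noteq> a \<otimes> b" using a b a1 by simp_all
    ultimately show thesis using that[of a b "a \<otimes> b"] a b by simp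
  next
    case False
    have "inv a = a" using sq a by (simp add: inv_equality)
    then have "ord (a \<otimes> b \<otimes> a) = 2" using ord_conj[OF a(1) b(1)] b by simp
    moreover have "a \<noteq> a \<otimes> b \<otimes> a"
    proof
      assume "a = a \<otimes> b \<otimes> a"
      then have "a \<otimes> b = \<one>" using a b by (metis l_one m_closed one_closed r_cancel)
      then show False using sq a b by (metis l_cancel)
    qed
    moreover have "b \<noteq> a \<otimes> b \<otimes> a"
    proof
      assume "b = a \<otimes> b \<otimes> a"
      then have "b \<otimes> a = (a \<otimes> b \<otimes> a) \<otimes> a" by (rule arg_cong)
      then have "b \<otimes> a = a \<otimes> b \<otimes> (a \<otimes> a)" using a b by (simp add: m_assoc)
      then show False using False sq a b by simp
    qed
    ultimately show thesis using that[of a b "a \<otimes> b \<otimes> a"] a b by simp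
  qed
qed

lemma generate_involution_eq:
  assumes "x \<in> carrier G" "i \<in> generate G {x}" "j \<in> generate G {x}" "ord i = 2" "ord j = 2"
  shows "i = j"
proof -
  have iG: "i \<in> carrier G" using assms generate_subset_carrier by blast
  have "j \<in> generate G {i}" using generate_of_ord_dvd[OF assms(1-3)] assms by simp
  then obtain k :: nat where k: "j = i [^] k" using in_generate_iff[OF iG] by blast
  show ?thesis
  proof (cases "even k")
    case True
    then have "j = \<one>" using k pow_eq_id[OF iG] assms by simp
    then show ?thesis using assms by simp
  next
    case False
    then have "[k = 1] (mod ord i)" using assms(4) by (simp add: cong_def odd_iff_mod_2_eq_one)
    then have "i [^] k = i [^] (1::nat)" using pow_cong[OF iG] by blast
    then show ?thesis using k iG by simp
  qed
qed

text \<open>Levels are appended in order of decreasing k. Since a level is ordered cyclically, it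
  can be rotated to start at any element, so a junction only needs one element of the new level
  outside the span of the current endpoint.\<close>

lemma two_group_path_of_large_order:
  assumes G: "order G = 2 ^ n" "\<not> cyclic_group G" "\<not> maximal_class_2_group G" and k: "2 \<le> k"
  shows "{x \<in> carrier G. 2 ^ k \<le> ord x} = {} \<or>
    (\<exists>xs. successively noncyclic_pair xs \<and> set xs = {x \<in> carrier G. 2 ^ k \<le> ord x} \<and> distinct xs)"
proof -
  define V where "V k = {x \<in> carrier G. 2 ^ k \<le> ord x}" for k :: nat
  have ppow: "\<exists>i\<le>n. ord x = 2 ^ i" if "x \<in> carrier G" for x
    using ord_dvd_group_order[OF that] G divides_primepow_nat[OF two_is_prime_nat] by auto
  \<comment> \<open>\<open>j\<close> turns descending induction on k into ordinary induction: no
    element has order 2^k or more once k \<ge> n + 2, and the step passes from k + 1 to k.\<close>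
  have "V k = {} \<or> (\<exists>xs. successively noncyclic_pair xs \<and> set xs = V k \<and> distinct xs)"
    if "2 \<le> k" "n + 2 \<le> k + j" for j k
    using that
  proof (induction j arbitrary: k)
    case 0
    have "V k = {}"
    proof (rule equals0I)
      fix x assume "x \<in> V k"
      then have x: "x \<in> carrier G" "2 ^ k \<le> ord x" unfolding V_def by auto
      obtain i where "i \<le> n" "ord x = 2 ^ i" using ppow x by blast
      then show False using x(2) 0 by simp
    qed
    then show ?case ..
  next
    case (Suc j)
    have IH: "V (Suc k) = {} \<or> (\<exists>xs. successively noncyclic_pair xs \<and> set xs = V (Suc k) \<and> distinct xs)"
      by (rule Suc.IH) (use Suc.prems in simp_all)
    define L where "L = {x \<in> carrier G. ord x = 2 ^ k}"
    have ge_iff: "2 ^ k \<le> ord x \<longleftrightarrow> ord x = 2 ^ k \<or> 2 ^ Suc k \<le> ord x" if x: "x \<in> carrier G" for x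
    proof -
      obtain i where i: "ord x = 2 ^ i" using ppow[OF x] by blast
      have "2 ^ k \<le> ord x \<longleftrightarrow> k \<le> i" "ord x = 2 ^ k \<longleftrightarrow> i = k" "2 ^ Suc k \<le> ord x \<longleftrightarrow> Suc k \<le> i"
        unfolding i by (simp_all del: power_Suc)
      then show ?thesis by auto
    qed
    have VL: "V k = V (Suc k) \<union> L" "V (Suc k) \<inter> L = {}"
      unfolding V_def L_def using ge_iff by auto
    show ?case
    proof (cases "L = {}")
      case True
      then show ?thesis using IH VL by simp
    next
      case False
      then obtain x where x: "x \<in> carrier G" "ord x = 2 ^ k" unfolding L_def by blast
      have "(2::nat) ^ 2 dvd 2 ^ k" using Suc.prems(1) by (rule le_imp_power_dvd)
      then have "4 dvd ord x" using x by simp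
      then obtain y where y: "y \<in> carrier G" "ord y = ord x" "y \<notin> generate G {x}"
        using two_group_unique_cyclic_subgroup[OF G(1) x(1)] G(2,3) by blast
      obtain xs where xs: "cyclically noncyclic_pair xs" "set xs = L" "distinct xs"
        using cyclic_ordering_of_ord_level[OF x(1) y] unfolding L_def x(2) by blast
      show ?thesis
      proof (cases "V (Suc k) = {}")
        case True
        then have "set xs = V k" using VL xs by simp
        then show ?thesis using xs unfolding cyclically_def by blast
      next
        case False
        then obtain zs where zs: "successively noncyclic_pair zs" "set zs = V (Suc k)" "distinct zs"
          using IH by blast
        have "zs \<noteq> []" using False zs(2) by auto
        then have l: "last zs \<in> carrier G" "2 ^ Suc k \<le> ord (last zs)" using zs(2) last_in_set unfolding V_def by blast+
        obtain i where i: "ord (last zs) = 2 ^ i" using ppow l by blast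
        then have "k \<le> i" using l(2) power_le_imp_le_exp[of "2::nat" "Suc k" i] by simp
        then have dvd: "2 ^ k dvd ord (last zs)" unfolding i by (rule le_imp_power_dvd)
        \<comment> \<open><last zs> has just one subgroup of order 2^k, so it cannot contain both x
          and y.\<close>
        have "\<exists>w\<in>L. w \<notin> generate G {last zs}"
        proof (cases "x \<in> generate G {last zs}")
          case True
          then have "y \<notin> generate G {last zs}" using generate_of_ord_dvd[OF l(1) True] y by auto
          then show ?thesis using y x unfolding L_def by auto
        next
          case False
          then show ?thesis using x unfolding L_def by auto
        qed
        then obtain w where w: "w \<in> L" "w \<notin> generate G {last zs}" by blast
        obtain ys where ys: "cyclically noncyclic_pair ys" "set ys = L" "distinct ys" "hd ys = w"
          using cyclically_rotate[OF xs(1) _ xs(3), of w] w xs(2) by auto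
        have "noncyclic_pair (last zs) w" by (rule noncyclic_pairI) (use w dvd in \<open>auto simp: L_def\<close>)
        then have "successively noncyclic_pair (zs @ ys)"
          using zs ys unfolding cyclically_def by (simp add: successively_append_iff)
        moreover have "set (zs @ ys) = V k" "distinct (zs @ ys)" using zs ys VL by auto
        ultimately show ?thesis by blast
      qed
    qed
  qed
  from this[of k "n + 2"] k show ?thesis unfolding V_def by simp
qed

text \<open>Distinct involutions are never in a common cyclic subgroup, so they may be listed in any
  order, with endpoints of choice. The span of each end of the path of larger orders contains at
  most one involution (\<open>u1\<close>, \<open>u2\<close>); with three at hand, distinct
  admissible neighbours for the two ends remain.\<close>

lemma two_group_cyclic_ordering:
  assumes G: "order G = 2 ^ n" "\<not> cyclic_group G" "\<not> maximal_class_2_group G"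
  obtains xs where "cyclically noncyclic_pair xs" "set xs = carrier G - {\<one>}" "distinct xs" "3 \<le> length xs"
proof -
  define I where "I = {x \<in> carrier G. ord x = 2}"
  define V where "V = {x \<in> carrier G. 2 ^ 2 \<le> ord x}"
  have part: "carrier G - {\<one>} = V \<union> I" "V \<inter> I = {}"
  proof -
    have "ord x = 1 \<or> ord x = 2 \<or> 2 ^ 2 \<le> ord x" if x: "x \<in> carrier G" for x
    proof -
      obtain i where i: "ord x = 2 ^ i"
        using ord_dvd_group_order[OF x] G divides_primepow_nat[OF two_is_prime_nat] by auto
      consider "i = 0" | "i = 1" | "2 \<le> i" by linarith
      then show ?thesis
      proof cases
        case 3
        then have "(2::nat) ^ 2 \<le> 2 ^ i" by (rule power_increasing) simp
        then show ?thesis using i by simp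
      qed (use i in auto)
    qed
    then show "carrier G - {\<one>} = V \<union> I" unfolding V_def I_def using ord_eq_1 by fastforce
    show "V \<inter> I = {}" unfolding V_def I_def by auto
  qed
  obtain a b c where abc: "a \<in> I" "b \<in> I" "c \<in> I" "a \<noteq> b" "a \<noteq> c" "b \<noteq> c"
    using two_group_three_involutions[OF G] unfolding I_def by blast
  have RI: "noncyclic_pair x y" if "x \<in> I" "y \<in> I" "x \<noteq> y" for x y
  proof (rule noncyclic_pairI)
    show "ord y dvd ord x" using that I_def by simp
    show "y \<notin> generate G {x}"
      using generate_involution_eq[of x x y] generate_self[of x] that unfolding I_def by auto
  qed
  have pathI: "successively noncyclic_pair is" if "set is \<subseteq> I" "distinct is" for "is"
    using that
  proof (induction "is")
    case (Cons i "is")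
    then show ?case using RI[of i "hd is"] by (auto simp: successively_Cons intro!: RI)
  qed simp
  have finI: "finite I" unfolding I_def using finite_carrier by simp
  have endpoints: "\<exists>is. set is = I \<and> distinct is \<and> hd is = i \<and> last is = j \<and> 3 \<le> length is"
    if ij: "i \<in> I" "j \<in> I" "i \<noteq> j" for i j
  proof -
    obtain ks where ks: "set ks = I - {i, j}" "distinct ks" using finI finite_distinct_list by (metis finite_Diff)
    have "a \<notin> {i, j} \<or> b \<notin> {i, j} \<or> c \<notin> {i, j}" using abc(4-6) by auto
    then have "I - {i, j} \<noteq> {}" using abc(1-3) by (elim disjE) auto
    then have "ks \<noteq> []" unfolding ks(1)[symmetric] by (simp only: set_empty simp_thms)
    then have "3 \<le> length (i # ks @ [j])" by (cases ks) auto
    moreover have "set (i # ks @ [j]) = I" "distinct (i # ks @ [j])" using ks ij by auto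
    ultimately show ?thesis by (intro exI[of _ "i # ks @ [j]"]) simp
  qed
  have one_inv: "\<exists>u. \<forall>w\<in>I. w \<noteq> u \<longrightarrow> w \<notin> generate G {v}" if v: "v \<in> carrier G" for v
    using generate_involution_eq[OF v] unfolding I_def by blast
  show thesis
  proof (cases "V = {}")
    case True
    obtain "is" where i: "set is = I" "distinct is" "hd is = a" "last is = b" "3 \<le> length is"
      using endpoints[of a b] abc by blast
    have "cyclically noncyclic_pair is"
      unfolding cyclically_def using i pathI[of "is"] RI[of b a] abc by auto
    then show ?thesis using that i part True by simp
  next
    case False
    then obtain vs where vs: "successively noncyclic_pair vs" "set vs = V" "distinct vs"
      using two_group_path_of_large_order[OF G, of 2] unfolding V_def by auto
    have ne: "vs \<noteq> []" using False vs by auto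
    then have hl: "hd vs \<in> V" "last vs \<in> V" using vs(2) hd_in_set last_in_set by blast+
    then have hlG: "hd vs \<in> carrier G" "last vs \<in> carrier G" unfolding V_def by auto
    obtain u1 u2 where u: "\<And>w. w \<in> I \<Longrightarrow> w \<noteq> u1 \<Longrightarrow> w \<notin> generate G {last vs}"
      "\<And>w. w \<in> I \<Longrightarrow> w \<noteq> u2 \<Longrightarrow> w \<notin> generate G {hd vs}"
      using one_inv[OF hlG(1)] one_inv[OF hlG(2)] by blast
    have "\<exists>i j. i \<in> I \<and> j \<in> I \<and> i \<noteq> j \<and> i \<noteq> u1 \<and> j \<noteq> u2" using abc by metis
    then obtain i j where ij: "i \<in> I" "j \<in> I" "i \<noteq> j" "i \<noteq> u1" "j \<noteq> u2" by blast
    obtain "is" where i: "set is = I" "distinct is" "hd is = i" "last is = j" "3 \<le> length is"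
      using endpoints[OF ij(1-3)] by blast
    have even: "2 dvd ord v" if "v \<in> V" for v
    proof -
      have v: "v \<in> carrier G" "2 ^ 2 \<le> ord v" using that V_def by auto
      obtain e where e: "ord v = 2 ^ e"
        using ord_dvd_group_order[OF v(1)] G divides_primepow_nat[OF two_is_prime_nat] by auto
      then have "e \<noteq> 0" using v by (intro notI) simp
      then show ?thesis using e by simp
    qed
    have "noncyclic_pair (last vs) i"
      by (rule noncyclic_pairI) (use u ij even hl in \<open>auto simp: I_def\<close>)
    moreover have "noncyclic_pair (hd vs) j"
      by (rule noncyclic_pairI) (use u ij even hl in \<open>auto simp: I_def\<close>)
    then have "noncyclic_pair j (hd vs)" using noncyclic_pair_commute by blast
    moreover have "is \<noteq> []" using i by auto
    ultimately have "cyclically noncyclic_pair (vs @ is)"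
      unfolding cyclically_def using vs(1) ne i pathI[of "is"] by (auto simp: successively_append_iff)
    moreover have "set (vs @ is) = carrier G - {\<one>}" "distinct (vs @ is)" "3 \<le> length (vs @ is)"
      using part vs i by auto
    ultimately show ?thesis by (rule that)
  qed
qed

section \<open>Adjacency in the graph, homomorphisms, and the permutation of the odd factor\<close>

lemma subgroup_of_cyclic:
  assumes c: "c \<in> carrier G" and H: "subgroup H G" "H \<subseteq> generate G {c}"
  obtains d where "d \<in> carrier G" "generate G {d} = H"
proof -
  define P where "P k \<longleftrightarrow> 0 < k \<and> c [^] k \<in> H" for k :: nat
  have "P (ord c)" unfolding P_def using ord_pos[OF c] pow_ord_eq_1[OF c] subgroup.one_closed[OF H(1)] by simp
  define m where "m = (LEAST k. P k)"
  have m: "0 < m" "c [^] m \<in> H" using LeastI[of P, OF \<open>P (ord c)\<close>] unfolding m_def P_def by simp_all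
  have cm: "c [^] m \<in> carrier G" using c by simp
  have "H \<subseteq> generate G {c [^] m}"
  proof
    fix h assume h: "h \<in> H"
    then obtain i :: nat where i: "h = c [^] i" using H(2) in_generate_iff[OF c] by blast
    define q where "q = (c [^] m) [^] (i div m)"
    have qH: "q \<in> H" unfolding q_def using subgroup_pow_closed[OF H(1) m(2)] .
    have "q \<otimes> c [^] (i mod m) = c [^] (m * (i div m) + i mod m)"
      unfolding q_def using c by (simp only: nat_pow_pow nat_pow_mult)
    then have "q \<otimes> c [^] (i mod m) = h" unfolding i by simp
    then have "c [^] (i mod m) = inv q \<otimes> h" using c subgroup.mem_carrier[OF H(1) qH] cancel_inv_left(1) by (metis nat_pow_closed)
    then have "c [^] (i mod m) \<in> H" using subgroup.m_closed[OF H(1)] subgroup.m_inv_closed[OF H(1)] qH h by simp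
    moreover have "\<not> P (i mod m)" using not_less_Least[of "i mod m" P] m(1) unfolding m_def by simp
    ultimately have "i mod m = 0" unfolding P_def by simp
    then have "i = m * (i div m)" by (metis add.right_neutral mult_div_mod_eq)
    then have "h = q" unfolding q_def i nat_pow_pow[OF c] by (rule arg_cong)
    then show "h \<in> generate G {c [^] m}" unfolding q_def using pow_in_generate[OF cm] by simp
  qed
  then show thesis using that[OF cm] generate_in_subgroup[OF H(1) m(2)] by blast
qed

text \<open>If <x, y> is cyclic, its generator serves as common overgroup; conversely <x, y> is a
  subgroup of the cyclic overgroup and hence cyclic.\<close>

lemma cyclic_subgroup_generated_pair_iff:
  assumes x: "x \<in> carrier G" and y: "y \<in> carrier G"
  shows "cyclic_group (subgroup_generated G {x, y}) \<longleftrightarrow> \<not> noncyclic_pair x y"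
proof -
  define H where "H = generate G {x, y}"
  have H: "subgroup H G" unfolding H_def by (rule generate_is_subgroup) (use x y in simp)
  have xy: "x \<in> H" "y \<in> H" unfolding H_def by (simp_all add: generate.incl)
  have eq: "subgroup_generated G {x, y} = G\<lparr>carrier := H\<rparr>"
    unfolding subgroup_generated_def H_def using x y by simp
  show ?thesis
  proof
    assume "cyclic_group (subgroup_generated G {x, y})"
    then obtain c where c: "c \<in> H" "subgroup_generated (G\<lparr>carrier := H\<rparr>) {c} = G\<lparr>carrier := H\<rparr>"
      unfolding cyclic_group_def eq by auto
    have "carrier (subgroup_generated (G\<lparr>carrier := H\<rparr>) {c}) = H" unfolding c(2) by simp
    then have "generate (G\<lparr>carrier := H\<rparr>) {c} = H" using c(1) by (simp add: carrier_subgroup_generated)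
    then have "generate G {c} = H" using generate_consistent[of "{c}" H] c(1) H by simp
    then show "\<not> noncyclic_pair x y" unfolding noncyclic_pair_def using xy c(1) subgroup.mem_carrier[OF H] by blast
  next
    assume "\<not> noncyclic_pair x y"
    then obtain c where c: "c \<in> carrier G" "x \<in> generate G {c}" "y \<in> generate G {c}"
      unfolding noncyclic_pair_def by blast
    have "H \<subseteq> generate G {c}" unfolding H_def
      by (rule generate_subgroup_incl) (use c generate_is_subgroup in auto)
    then obtain d where d: "d \<in> carrier G" "generate G {d} = H" using subgroup_of_cyclic[OF c(1) H] by blast
    have "subgroup_generated G {d} = G\<lparr>carrier := H\<rparr>" unfolding subgroup_generated_def using d by simp
    then show "cyclic_group (subgroup_generated G {x, y})" unfolding eq using cyclic_group_generated[of d] by simp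
  qed
qed

lemma parcs_noncyclic_graph:
  assumes x: "x \<in> carrier G" and y: "y \<in> carrier G" and xy: "noncyclic_pair x y"
  shows "(x, y) \<in> parcs (noncyclic_graph G)"
proof -
  have "x \<noteq> y" using xy x generate_self[OF x] unfolding noncyclic_pair_def by blast
  moreover have "\<not> cyclic_group (subgroup_generated G {x, y})" "\<not> cyclic_group (subgroup_generated G {y, x})"
    using cyclic_subgroup_generated_pair_iff[OF x y] xy by (simp_all add: insert_commute)
  ultimately show ?thesis unfolding noncyclic_graph_def Cyc_def using x y by auto
qed

text \<open>A homomorphism carries a common overgroup <c> to <f c>. Applied to projections of the
  direct product, this lifts non-cyclic pairs from a factor.\<close>

lemma noncyclic_pair_of_hom:
  assumes K: "finite_group K" and f: "f \<in> hom G K" and "finite_group.noncyclic_pair K (f x) (f y)"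
  shows "noncyclic_pair x y"
proof -
  interpret K: finite_group K by (rule K)
  interpret f: group_hom G K f by (intro group_hom.intro group_hom_axioms.intro is_group K.is_group f)
  have "f z \<in> generate K {f c}" if c: "c \<in> carrier G" "z \<in> generate G {c}" for z c
    using c in_generate_iff[OF c(1)] K.in_generate_iff[OF f.hom_closed[OF c(1)]] f.hom_nat_pow[OF c(1)] by auto
  then show ?thesis using assms(3) f.hom_closed unfolding noncyclic_pair_def K.noncyclic_pair_def by blast
qed

text \<open>On each set of elements of equal order the cyclic successor is used. It preserves
  orders, so the maps for the various orders fit together to an injection of a finite set into
  itself.\<close>

lemma nilpotent_noncyclic_permutation:
  assumes nil: "nilpotent_group G" and od: "odd (order G)" and syl: "no_cyclic_sylow G"
  obtains f where "bij_betw f (carrier G - {\<one>}) (carrier G - {\<one>})"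
    "\<And>h. h \<in> carrier G - {\<one>} \<Longrightarrow> noncyclic_pair h (f h)"
proof -
  define L where "L N = {z \<in> carrier G. ord z = N}" for N
  have "\<exists>f. bij_betw f (L N) (L N) \<and> (\<forall>h\<in>L N. noncyclic_pair h (f h))" if N: "N \<in> ord ` (carrier G - {\<one>})" for N
  proof -
    obtain g where g: "g \<in> carrier G" "g \<noteq> \<one>" "ord g = N" using N by blast
    obtain h where h: "h \<in> carrier G" "ord h = ord g" "h \<notin> generate G {g}"
      using nilpotent_another_cyclic_subgroup[OF nil od syl g(1,2)] by blast
    obtain xs where xs: "cyclically noncyclic_pair xs" "set xs = L N" "distinct xs"
      using cyclic_ordering_of_ord_level[OF g(1) h] unfolding L_def g(3) by blast
    obtain f where "bij_betw f (set xs) (set xs)" "\<And>x. x \<in> set xs \<Longrightarrow> noncyclic_pair x (f x)"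
      using cyclically_permutation[OF xs(1,3)] by blast
    then show ?thesis unfolding xs(2) by blast
  qed
  then obtain F where F: "\<And>N. N \<in> ord ` (carrier G - {\<one>}) \<Longrightarrow> bij_betw (F N) (L N) (L N)"
    "\<And>N h. N \<in> ord ` (carrier G - {\<one>}) \<Longrightarrow> h \<in> L N \<Longrightarrow> noncyclic_pair h (F N h)" by metis
  define f where "f h = F (ord h) h" for h
  have f: "f h \<in> carrier G - {\<one>} \<and> ord (f h) = ord h \<and> noncyclic_pair h (f h)" if h: "h \<in> carrier G - {\<one>}" for h
  proof -
    have hL: "h \<in> L (ord h)" unfolding L_def using h by simp
    have "ord h \<in> ord ` (carrier G - {\<one>})" using h by blast
    note FN = F(1)[OF this] F(2)[OF this hL]
    have "f h \<in> L (ord h)" unfolding f_def using FN(1) hL bij_betwE by blast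
    then have fh: "f h \<in> carrier G" "ord (f h) = ord h" unfolding L_def by auto
    moreover have "f h \<noteq> \<one>"
    proof
      assume "f h = \<one>"
      then have "ord h = 1" using fh(2) by simp
      then show False using h ord_eq_1 by blast
    qed
    ultimately show ?thesis using FN(2) unfolding f_def by simp
  qed
  have "inj_on f (carrier G - {\<one>})"
  proof (rule inj_onI)
    fix x y assume xy: "x \<in> carrier G - {\<one>}" "y \<in> carrier G - {\<one>}" "f x = f y"
    then have o: "ord x = ord y" using f by metis
    have "bij_betw (F (ord x)) (L (ord x)) (L (ord x))" using F(1) xy(1) by blast
    moreover have "F (ord x) x = F (ord x) y" using xy(3) o unfolding f_def by simp
    moreover have "x \<in> L (ord x)" "y \<in> L (ord x)" unfolding L_def using xy o by auto
    ultimately show "x = y" unfolding bij_betw_def inj_on_def by blast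
  qed
  moreover have "f ` (carrier G - {\<one>}) \<subseteq> carrier G - {\<one>}"
    using f[THEN conjunct1] by (rule image_subsetI)
  ultimately have "bij_betw f (carrier G - {\<one>}) (carrier G - {\<one>})"
    unfolding bij_betw_def using finite_carrier by (simp add: endo_inj_surj)
  then show thesis using f[THEN conjunct2, THEN conjunct2] by (rule that)
qed

end

section \<open>The Hamiltonian cycle\<close>

lemma DirProd_nat_pow: "(a, b) [^]\<^bsub>G \<times>\<times> H\<^esub> (k::nat) = (a [^]\<^bsub>G\<^esub> k, b [^]\<^bsub>H\<^esub> k)"
  by (induction k) simp_all

lemma finite_group_DirProd: "finite_group G \<Longrightarrow> finite_group H \<Longrightarrow> finite_group (G \<times>\<times> H)"
  unfolding finite_group_def finite_group_axioms_def by (simp add: DirProd_group)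

lemma finite_group_integer_mod_group: "1 \<le> n \<Longrightarrow> finite_group (integer_mod_group n)"
  unfolding finite_group_def finite_group_axioms_def by (simp add: carrier_integer_mod_group)

text \<open>For every q in Q the element (1, q) spans all pairs (v, q^j), by the Chinese remainder
  theorem for n and the order of q. So (z, 1) and (w, q) have a common cyclic overgroup.\<close>

lemma Cyc_integer_mod_group_DirProd:
  assumes n: "1 \<le> n" and Q: "finite_group Q" and cop: "coprime n (order Q)" and z: "z \<in> carrier (integer_mod_group n)"
  shows "(z, \<one>\<^bsub>Q\<^esub>) \<in> Cyc (integer_mod_group n \<times>\<times> Q)"
proof -
  let ?M = "integer_mod_group n \<times>\<times> Q"
  interpret Q: finite_group Q by (rule Q)
  interpret M: finite_group ?M by (rule finite_group_DirProd[OF finite_group_integer_mod_group[OF n] Q])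
  have "cyclic_group (subgroup_generated ?M {(z, \<one>\<^bsub>Q\<^esub>), y})" if y: "y \<in> carrier ?M" for y
  proof -
    obtain w q where wq: "y = (w, q)" "w \<in> carrier (integer_mod_group n)" "q \<in> carrier Q" using y by auto
    \<comment> \<open>The reduction \<open>1 mod int n\<close> keeps the generator inside the
      carrier when n = 1.\<close>
    define e where "e = (1 mod int n, q)"
    have eM: "e \<in> carrier ?M" unfolding e_def using wq n by (auto simp: carrier_integer_mod_group)
    have "coprime n (Q.ord q)" using cop Q.ord_dvd_group_order[OF wq(3)] coprime_divisors dvd_refl by blast
    have mem: "(v, q [^]\<^bsub>Q\<^esub> j) \<in> generate ?M {e}" if v: "v \<in> carrier (integer_mod_group n)" for v and j :: nat
    proof -
      have v': "0 \<le> v" "v < int n" using v n by (auto simp: carrier_integer_mod_group)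
      obtain i where i: "[i = nat v] (mod n)" "[i = j] (mod Q.ord q)"
        using binary_chinese_remainder_nat[OF \<open>coprime n (Q.ord q)\<close>] by blast
      have "int i mod int n = v"
      proof -
        have "int (i mod n) = int (nat v mod n)" using i(1) unfolding cong_def by simp
        then show ?thesis using v' by (simp add: zmod_int)
      qed
      moreover have "(1 mod int n) [^]\<^bsub>integer_mod_group n\<^esub> i = int i mod int n"
        by (simp add: mod_mult_right_eq)
      moreover have "q [^]\<^bsub>Q\<^esub> i = q [^]\<^bsub>Q\<^esub> j" using Q.pow_cong[OF wq(3)] i(2) by blast
      ultimately have "(v, q [^]\<^bsub>Q\<^esub> j) = e [^]\<^bsub>?M\<^esub> i" unfolding e_def DirProd_nat_pow by simp
      then show ?thesis using M.pow_in_generate[OF eM] by simp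
    qed
    have "(z, \<one>\<^bsub>Q\<^esub>) \<in> generate ?M {e}" using mem[OF z, of 0] by simp
    moreover have "y \<in> generate ?M {e}" using mem[OF wq(2), of 1] wq by simp
    moreover have "(z, \<one>\<^bsub>Q\<^esub>) \<in> carrier ?M" using z by simp
    ultimately show ?thesis
      using M.cyclic_subgroup_generated_pair_iff[OF _ y, of "(z, \<one>\<^bsub>Q\<^esub>)"] eM M.noncyclic_pair_def by blast
  qed
  then show ?thesis unfolding Cyc_def using z by simp
qed

theorem theorem3p8:
  fixes n :: nat
    and P :: "('a, 'c) monoid_scheme"
    and \<G> :: "('b, 'd) monoid_scheme"
  assumes "n \<ge> 1"
    and "group P" and "finite (carrier P)" and "\<exists>k. order P = 2 ^ k"
    and "\<not> cyclic_group P" and "\<not> maximal_class_2_group P"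
    and "group \<G>" and "finite (carrier \<G>)" and "nilpotent_group \<G>"
    and "odd (order \<G>)" and "no_cyclic_sylow \<G>"
    and "gcd n (order \<G>) = 1" and "gcd n 2 = 1"
  shows "hamiltonian (with_proj (noncyclic_graph (integer_mod_group n \<times>\<times> P \<times>\<times> \<G>)))"
proof -
  let ?Z = "integer_mod_group n"
  let ?M = "?Z \<times>\<times> P \<times>\<times> \<G>"
  interpret P: finite_group P using assms(2,3) by (simp add: finite_group_def finite_group_axioms_def)
  interpret N: finite_group \<G> using assms(7,8) by (simp add: finite_group_def finite_group_axioms_def)
  interpret Z: finite_group ?Z by (rule finite_group_integer_mod_group[OF assms(1)])
  have PN: "finite_group (P \<times>\<times> \<G>)" by (rule finite_group_DirProd) unfold_locales
  interpret M: finite_group ?M by (rule finite_group_DirProd[OF Z.finite_group_axioms PN])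
  define R where "R = M.noncyclic_pair"
  have RP: "R (z, p, h) (z', p', h')" if "P.noncyclic_pair p p'" for z p h z' p' h'
    unfolding R_def
    by (rule M.noncyclic_pair_of_hom[OF P.finite_group_axioms, of "fst \<circ> snd"])
      (use that in \<open>auto simp: hom_def mult_DirProd'\<close>)
  have RN: "R (z, p, h) (z', p', h')" if "N.noncyclic_pair h h'" for z p h z' p' h'
    unfolding R_def
    by (rule M.noncyclic_pair_of_hom[OF N.finite_group_axioms, of "snd \<circ> snd"])
      (use that in \<open>auto simp: hom_def mult_DirProd'\<close>)
  obtain k where k: "order P = 2 ^ k" using assms(4) by blast
  obtain ps where ps: "cyclically P.noncyclic_pair ps" "set ps = carrier P - {\<one>\<^bsub>P\<^esub>}" "distinct ps" "3 \<le> length ps"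
    using P.two_group_cyclic_ordering[OF k assms(5,6)] by blast
  obtain p1 ps' where p1: "ps = p1 # ps'" using ps(4) by (cases ps) auto
  have ps': "ps' \<noteq> []" using ps(4) p1 by auto
  obtain f where f: "bij_betw f (carrier \<G> - {\<one>\<^bsub>\<G>\<^esub>}) (carrier \<G> - {\<one>\<^bsub>\<G>\<^esub>})"
    "\<And>h. h \<in> carrier \<G> - {\<one>\<^bsub>\<G>\<^esub>} \<Longrightarrow> N.noncyclic_pair h (f h)"
    using N.nilpotent_noncyclic_permutation[OF assms(9,10,11)] by blast
  \<comment> \<open>The inserted vertex stands between two vertices with last component h, so the
    one relation between h and f h serves on both sides, whatever the components in P are.\<close>
  define block where "block = (\<lambda>(z::int, h). (z, p1, h) # (if h = \<one>\<^bsub>\<G>\<^esub> then [] else [(z, \<one>\<^bsub>P\<^esub>, f h)]) @ map (\<lambda>p. (z, p, h)) ps')"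
  obtain ls where ls: "set ls = carrier ?Z \<times> carrier \<G>" "distinct ls"
    using finite_distinct_list[of "carrier ?Z \<times> carrier \<G>"] Z.finite_carrier N.finite_carrier by blast
  define vs where "vs = concat (map block ls)"
  have p_mem: "p1 \<in> carrier P - {\<one>\<^bsub>P\<^esub>}" "set ps' \<subseteq> carrier P - {\<one>\<^bsub>P\<^esub>}" "p1 \<notin> set ps'" "distinct ps'"
    using ps(2,3) p1 by auto
  have f_mem: "f h \<in> carrier \<G> - {\<one>\<^bsub>\<G>\<^esub>}" if "h \<in> carrier \<G>" "h \<noteq> \<one>\<^bsub>\<G>\<^esub>" for h
    using bij_betwE[OF f(1)] that by blast
  have set_block: "set (block (z, h)) = {(z, p, h) | p. p \<in> carrier P - {\<one>\<^bsub>P\<^esub>}} \<union> (if h = \<one>\<^bsub>\<G>\<^esub> then {} else {(z, \<one>\<^bsub>P\<^esub>, f h)})" for z h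
    unfolding block_def ps(2)[symmetric] p1 by auto
  have set_vs: "set vs = {(z, p, h). z \<in> carrier ?Z \<and> p \<in> carrier P \<and> h \<in> carrier \<G> \<and> (p, h) \<noteq> (\<one>\<^bsub>P\<^esub>, \<one>\<^bsub>\<G>\<^esub>)}"
  proof (intro Set.set_eqI iffI)
    fix v assume "v \<in> set vs"
    then obtain z h where zh: "z \<in> carrier ?Z" "h \<in> carrier \<G>" "v \<in> set (block (z, h))" unfolding vs_def using ls(1) by auto
    then show "v \<in> {(z, p, h). z \<in> carrier ?Z \<and> p \<in> carrier P \<and> h \<in> carrier \<G> \<and> (p, h) \<noteq> (\<one>\<^bsub>P\<^esub>, \<one>\<^bsub>\<G>\<^esub>)}"
      using f_mem[of h] unfolding set_block by (auto split: if_splits)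
  next
    fix v assume "v \<in> {(z, p, h). z \<in> carrier ?Z \<and> p \<in> carrier P \<and> h \<in> carrier \<G> \<and> (p, h) \<noteq> (\<one>\<^bsub>P\<^esub>, \<one>\<^bsub>\<G>\<^esub>)}"
    then obtain z p h where v: "v = (z, p, h)" "z \<in> carrier ?Z" "p \<in> carrier P" "h \<in> carrier \<G>" "(p, h) \<noteq> (\<one>\<^bsub>P\<^esub>, \<one>\<^bsub>\<G>\<^esub>)" by auto
    have "\<exists>h'\<in>carrier \<G>. v \<in> set (block (z, h'))"
    proof (cases "p = \<one>\<^bsub>P\<^esub>")
      case True
      then have "h \<in> f ` (carrier \<G> - {\<one>\<^bsub>\<G>\<^esub>})" using v f(1) unfolding bij_betw_def by auto
      then show ?thesis unfolding v(1) set_block using True by auto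
    next
      case False
      then show ?thesis unfolding v(1) set_block using v by auto
    qed
    then show "v \<in> set vs" unfolding vs_def using ls(1) v(2) by auto
  qed
  have block_props: "block l \<noteq> []" "successively R (block l)" "\<exists>z h. hd (block l) = (z, p1, h)" "\<exists>z h. last (block l) = (z, last ps', h)"
    if l: "l \<in> set ls" for l
  proof -
    obtain z h where zh: "l = (z, h)" "z \<in> carrier ?Z" "h \<in> carrier \<G>" using l ls(1) by auto
    show "block l \<noteq> []" "\<exists>z h. hd (block l) = (z, p1, h)" "\<exists>z h. last (block l) = (z, last ps', h)"
      unfolding zh(1) block_def using ps' by (simp_all add: last_map)
    have path: "P.noncyclic_pair p1 (hd ps')" "successively P.noncyclic_pair ps'"
      using ps(1) ps' unfolding cyclically_def p1 by (simp_all add: successively_Cons)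
    have "successively R (map (\<lambda>p. (z, p, h)) ps')"
      unfolding successively_map by (rule successively_mono[OF path(2)]) (use RP in auto)
    moreover have "R (z, p1, h) (z, \<one>\<^bsub>P\<^esub>, f h)" "R (z, \<one>\<^bsub>P\<^esub>, f h) (z, hd ps', h)" if "h \<noteq> \<one>\<^bsub>\<G>\<^esub>"
      using RN f(2)[of h] that zh(3) N.noncyclic_pair_commute by simp_all
    moreover have "R (z, p1, h) (z, hd ps', h)" using RP path(1) by blast
    ultimately show "successively R (block l)"
      unfolding zh(1) block_def using ps' by (cases "h = \<one>\<^bsub>\<G>\<^esub>") (simp_all add: successively_Cons hd_map)
  qed
  have "cyclically R vs" unfolding vs_def
  proof (rule cyclically_concat)
    have "(\<one>\<^bsub>?Z\<^esub>, \<one>\<^bsub>\<G>\<^esub>) \<in> set ls" unfolding ls(1) using Z.one_closed by simp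
    then show "map block ls \<noteq> []" by auto
    show "b \<noteq> [] \<and> successively R b" if "b \<in> set (map block ls)" for b using that block_props(1,2) by auto
    \<comment> \<open>The closing pair of \<open>ps\<close> joins the end of any block to the start
      of any block, whatever their labels (z, h); hence \<open>ls\<close> can be an arbitrary
      enumeration.\<close>
    show "R (last b) (hd b')" if "b \<in> set (map block ls)" "b' \<in> set (map block ls)" for b b'
    proof -
      have "P.noncyclic_pair (last ps') p1" using ps(1) ps' unfolding cyclically_def p1 by simp
      then show ?thesis using that block_props(3,4) RP by fastforce
    qed
  qed
  then have "cyclically (\<lambda>u v. (u, v) \<in> parcs (noncyclic_graph ?M)) vs"
  proof -
    assume c: "cyclically R vs"
    have R: "(u, v) \<in> parcs (noncyclic_graph ?M)" if "u \<in> set vs" "v \<in> set vs" "R u v" for u v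
      by (rule M.parcs_noncyclic_graph) (use that set_vs in \<open>auto simp: R_def\<close>)
    show ?thesis
      unfolding cyclically_def
    proof (intro conjI)
      show ne: "vs \<noteq> []" using c unfolding cyclically_def by simp
      show "(last vs, hd vs) \<in> parcs (noncyclic_graph ?M)" using ne R c unfolding cyclically_def by simp
      show "successively (\<lambda>u v. (u, v) \<in> parcs (noncyclic_graph ?M)) vs"
        by (rule successively_mono[of R]) (use c R in \<open>auto simp: cyclically_def\<close>)
    qed
  qed
  moreover have "distinct vs" unfolding vs_def
  proof (rule distinct_concat)
    have meet: "l = l'" if lm: "l \<in> set ls" "l' \<in> set ls" "set (block l) \<inter> set (block l') \<noteq> {}" for l l'
    proof -
      obtain z h z' h' where zh: "l = (z, h)" "h \<in> carrier \<G>" "l' = (z', h')" "h' \<in> carrier \<G>" using lm ls(1) by auto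
      \<comment> \<open>Blocks with different labels can meet only in their inserted vertices, and
        injectivity of f keeps these apart.\<close>
      have "inj_on f (carrier \<G> - {\<one>\<^bsub>\<G>\<^esub>})" using f(1) unfolding bij_betw_def by simp
      then have "f h = f h' \<Longrightarrow> h \<noteq> \<one>\<^bsub>\<G>\<^esub> \<Longrightarrow> h' \<noteq> \<one>\<^bsub>\<G>\<^esub> \<Longrightarrow> h = h'" using zh unfolding inj_on_def by blast
      then show ?thesis using lm(3) unfolding zh(1,3) set_block by (auto split: if_splits)
    qed
    show "distinct (map block ls)"
      unfolding distinct_map using ls(2) meet block_props(1) by (auto simp: inj_on_def)
    show "distinct b" if b: "b \<in> set (map block ls)" for b
    proof -
      obtain z h where "b = block (z, h)" using b by auto
      then show ?thesis unfolding block_def using p_mem by (auto simp: distinct_map inj_on_def)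
    qed
    show "set b \<inter> set b' = {}" if "b \<in> set (map block ls)" "b' \<in> set (map block ls)" "b \<noteq> b'" for b b'
      using that meet unfolding set_map by blast
  qed
  moreover have "3 \<le> length vs"
  proof -
    have "(\<lambda>p. (0::int, p, \<one>\<^bsub>\<G>\<^esub>)) ` set ps \<subseteq> set vs" unfolding set_vs ps(2) using Z.one_closed by auto
    then have "card ((\<lambda>p. (0::int, p, \<one>\<^bsub>\<G>\<^esub>)) ` set ps) \<le> card (set vs)" by (intro card_mono) auto
    moreover have "card ((\<lambda>p. (0::int, p, \<one>\<^bsub>\<G>\<^esub>)) ` set ps) = length ps"
      using ps(3) by (subst card_image) (auto simp: inj_on_def distinct_card)
    ultimately show ?thesis using ps(4) card_length[of vs] by linarith
  qed
  moreover have "set vs = pverts (noncyclic_graph ?M)"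
  proof -
    have "order (P \<times>\<times> \<G>) = order P * order \<G>" unfolding order_def by (simp add: card_cartesian_product)
    moreover have "coprime n (order \<G>)" using assms(12) by (simp only: coprime_iff_gcd_eq_1)
    moreover have "coprime n (order P)"
    proof -
      have "coprime n 2" using assms(13) by (simp only: coprime_iff_gcd_eq_1)
      then show ?thesis unfolding k by simp
    qed
    ultimately have "coprime n (order (P \<times>\<times> \<G>))" by simp
    then have "(z, \<one>\<^bsub>P\<^esub>, \<one>\<^bsub>\<G>\<^esub>) \<in> Cyc ?M" if "z \<in> carrier ?Z" for z
      using Cyc_integer_mod_group_DirProd[OF assms(1) PN _ that] by simp
    then have "pverts (noncyclic_graph ?M) \<subseteq> set vs" unfolding noncyclic_graph_def set_vs by auto
    \<comment> \<open>A vertex of the cycle has an arc to its successor, and arcs join only elements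
      outside \<open>Cyc\<close>.\<close>
    moreover have "set vs \<subseteq> pverts (noncyclic_graph ?M)"
    proof
      fix v assume v: "v \<in> set vs"
      then obtain i where i: "i < length vs" "v = vs ! i" by (auto simp: in_set_conv_nth)
      then have "\<exists>w. (v, w) \<in> parcs (noncyclic_graph ?M)"
        using cyclically_nth[OF \<open>cyclically (\<lambda>u v. (u, v) \<in> parcs (noncyclic_graph ?M)) vs\<close> i(1)] by blast
      then show "v \<in> pverts (noncyclic_graph ?M)" unfolding noncyclic_graph_def by auto
    qed
    ultimately show ?thesis by blast
  qed
  ultimately show ?thesis by (intro hamiltonian_of_cyclically)
qed



end
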